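(* Let $z\in\mathbb{C}^{(2f_c+1)^d}$ (indexed by $\Omega_c$). For any $\ell\ge f_c$, $$\min \mathcal{Q}_0^{(\ell)}(z)\ \le\ \min \mathcal{Q}_0^{(\ell+1)}(z)\ \le\ \min\mathcal{Q}_0(z).$$ Moreover, $\lim_{\ell\to+\infty}\min\mathcal{Q}_0^{(\ell)}(z)=\min\mathcal{Q}_0(z)$.
   Context: $\mathbb{T}^d=(\mathbb{R}/\mathbb{Z})^d$; $\mathcal{M}(\mathbb{T}^d)$ is the space of bounded complex Radon measures on $\mathbb{T}^d$, and $|\mu|(\mathbb{T}^d)$ is the total variation norm of $\mu$. $f_c\in\mathbb{N}^*$ is fixed, $\Omega_\ell=\{-\ell,\dots,\ell\}^d$ and $\Omega_c=\{-f_c,\dots,f_c\}^d$. For $k\in\mathbb{Z}^d$, $c_k(\mu)=\int_{\mathbb{T}^d}e^{-2i\pi\langle k,x\rangle}\,\mathrm{d}\mu(x)$. Problem $\mathcal{Q}_0(z)$: $$\min_{\mu\in\mathcal{M}(\mathbb{T}^d)}|\mu|(\mathbb{T}^d)\quad\text{s.t.}\quad c_k(\mu)=z_k\ \ \forall k\in\Omega_c .$$ For $\ell\ge f_c$ let $m=(2\ell+1)^d$; vectors in $\mathbb{C}^m$ and matrices in $\mathbb{C}^{m\times m}$ are indexed by $\Omega_\ell$. A matrix $R\in\mathbb{C}^{m\times m}$ is a generalized Toeplitz matrix, written $R\in\mathcal{T}_m$, if $R_{i+k,j+k}=R_{i,j}$ for all $i,j,k\in\Omega_\ell$ with $\|i+k\|_\infty\le\ell$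 and $\|j+k\|_\infty\le\ell$. Problem $\mathcal{Q}_0^{(\ell)}(z)$: minimize $$\frac12\Big(\frac1m\mathrm{Tr}(R)+\tau\Big)$$ over Hermitian positive semidefinite $R\in\mathbb{C}^{m\times m}$, $\tilde z\in\mathbb{C}^{m}$, $\tau\in\mathbb{R}$, subject to (a) $\begin{bmatrix}R&\tilde z\\ \tilde z^*&\tau\end{bmatrix}\succeq0$; (b) $\tilde z_k=z_k$ for all $k\in\Omega_c$; (c) $R\in\mathcal{T}_m$. $\min\mathcal{Q}$ denotes the optimal value of the problem $\mathcal{Q}$. *)

theory Defs
  imports "HOL-Analysis.Analysis"
begin

definition int_translate :: "real ^ 'd \<Rightarrow> real ^ 'd \<Rightarrow> bool" where
  "int_translate x y \<longleftrightarrow> (\<forall>i. x $ i - y $ i \<in> \<int>)"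

lemma equivp_int_translate: "equivp (int_translate :: real ^ 'd \<Rightarrow> real ^ 'd \<Rightarrow> bool)"
proof (rule equivpI)
  show "reflp (int_translate :: real ^ 'd \<Rightarrow> _)"
    by (simp add: reflp_def int_translate_def)
  show "symp (int_translate :: real ^ 'd \<Rightarrow> _)"
    unfolding symp_def int_translate_def by (metis Ints_minus minus_diff_eq)
  show "transp (int_translate :: real ^ 'd \<Rightarrow> _)"
    unfolding transp_def int_translate_def
    by (metis Ints_add add_diff_eq diff_add_cancel)
qed

text \<open>\<open>(\<real>/\<int>)\<^sup>d\<close>, obtained as \<open>\<real>\<^sup>d/\<int>\<^sup>d\<close>, with the quotient topology.\<close>

quotient_type 'd torus = "real ^ 'd::finite" / int_translate
  by (rule equivp_int_translate)

instantiation torus :: (finite) topological_space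
begin

definition open_torus :: "'a torus set \<Rightarrow> bool" where
  "open_torus U \<longleftrightarrow> open (abs_torus -` U)"

instance
  by standard (auto simp: open_torus_def vimage_Union)

end

lift_definition torus_char :: "int ^ 'd \<Rightarrow> 'd::finite torus \<Rightarrow> complex" is
  "\<lambda>k x. exp (- (2 * \<i> * complex_of_real pi * complex_of_real (\<Sum>i\<in>UNIV. real_of_int (k $ i) * x $ i)))"
proof -
  fix k :: "int ^ 'd" and x y :: "real ^ 'd"
  assume "int_translate x y"
  then have "(\<Sum>i\<in>UNIV. real_of_int (k $ i) * (x $ i - y $ i)) \<in> \<int>"
    by (auto simp: int_translate_def)
  then obtain n where n: "(\<Sum>i\<in>UNIV. real_of_int (k $ i) * (x $ i - y $ i)) = of_int n"
    by (elim Ints_cases)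
  have "(\<Sum>i\<in>UNIV. real_of_int (k $ i) * x $ i) = (\<Sum>i\<in>UNIV. real_of_int (k $ i) * y $ i) + of_int n"
    unfolding n[symmetric] by (simp add: sum.distrib[symmetric] algebra_simps)
  then show "exp (- (2 * \<i> * complex_of_real pi * complex_of_real (\<Sum>i\<in>UNIV. real_of_int (k $ i) * x $ i)))
    = exp (- (2 * \<i> * complex_of_real pi * complex_of_real (\<Sum>i\<in>UNIV. real_of_int (k $ i) * y $ i)))"
    by (auto simp: exp_eq algebra_simps intro!: exI[of _ "- n"])
qed

definition complex_borel_measure :: "('a::topological_space set \<Rightarrow> complex) \<Rightarrow> bool" where
  "complex_borel_measure \<mu> \<longleftrightarrow>
     (\<forall>A :: nat \<Rightarrow> 'a set. range A \<subseteq> sets borel \<longrightarrow> disjoint_family A \<longrightarrow>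
        (\<lambda>n. \<mu> (A n)) sums \<mu> (\<Union>n. A n))"

definition variation :: "('a::topological_space set \<Rightarrow> complex) \<Rightarrow> 'a set \<Rightarrow> ennreal" where
  "variation \<mu> A =
     (SUP E \<in> {E :: nat \<Rightarrow> 'a set. range E \<subseteq> sets borel \<and> disjoint_family E \<and> (\<Union>n. E n) = A}.
        \<Sum>n. ennreal (cmod (\<mu> (E n))))"

definition bounded_radon_measure :: "('a::topological_space set \<Rightarrow> complex) \<Rightarrow> bool" where
  "bounded_radon_measure \<mu> \<longleftrightarrow>
     complex_borel_measure \<mu> \<and> variation \<mu> UNIV < \<infinity> \<and>
     (\<forall>A \<in> sets borel. variation \<mu> A = (SUP K \<in> {K. compact K \<and> K \<subseteq> A}. variation \<mu> K))"

text \<open>The positive part in the Jordan decomposition of a signed measure \<open>\<nu>\<close>; the negative part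
  is the positive part of \<open>- \<nu>\<close>.\<close>

definition jordan_pos :: "('a::topological_space set \<Rightarrow> real) \<Rightarrow> 'a measure" where
  "jordan_pos \<nu> = measure_of UNIV (sets borel)
     (\<lambda>A. SUP B \<in> {B \<in> sets borel. B \<subseteq> A}. ennreal (\<nu> B))"

text \<open>Integration of a bounded Borel function against a signed, then against a complex measure.
  For measures of finite variation both Jordan parts are finite measures, so the integrals of
  bounded functions are never the default value \<open>0\<close> of a non-integrable function.\<close>

definition signed_integral :: "('a::topological_space set \<Rightarrow> real) \<Rightarrow> ('a \<Rightarrow> complex) \<Rightarrow> complex" where
  "signed_integral \<nu> f = (\<integral>x. f x \<partial>jordan_pos \<nu>) - (\<integral>x. f x \<partial>jordan_pos (\<lambda>A. - \<nu> A))"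

definition cmeasure_integral :: "('a::topological_space set \<Rightarrow> complex) \<Rightarrow> ('a \<Rightarrow> complex) \<Rightarrow> complex" where
  "cmeasure_integral \<mu> f =
     signed_integral (\<lambda>A. Re (\<mu> A)) f + \<i> * signed_integral (\<lambda>A. Im (\<mu> A)) f"

definition fourier_coeff :: "('d::finite torus set \<Rightarrow> complex) \<Rightarrow> int ^ 'd \<Rightarrow> complex" where
  "fourier_coeff \<mu> k = cmeasure_integral \<mu> (torus_char k)"

definition hermitian_on :: "'i set \<Rightarrow> ('i \<Rightarrow> 'i \<Rightarrow> complex) \<Rightarrow> bool" where
  "hermitian_on I A \<longleftrightarrow> (\<forall>i\<in>I. \<forall>j\<in>I. A j i = cnj (A i j))"

text \<open>The quadratic form of a Hermitian matrix is real valued, so taking \<open>Re\<close> loses nothing.\<close>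

definition psd_on :: "'i set \<Rightarrow> ('i \<Rightarrow> 'i \<Rightarrow> complex) \<Rightarrow> bool" where
  "psd_on I A \<longleftrightarrow> hermitian_on I A \<and>
     (\<forall>v. 0 \<le> Re (\<Sum>i\<in>I. \<Sum>j\<in>I. cnj (v i) * A i j * v j))"

text \<open>The block matrix \<open>[R, w; w\<^sup>*, \<tau>]\<close>; the index \<open>None\<close> is the added row and column.\<close>

fun bordered :: "('i \<Rightarrow> 'i \<Rightarrow> complex) \<Rightarrow> ('i \<Rightarrow> complex) \<Rightarrow> real \<Rightarrow> 'i option \<Rightarrow> 'i option \<Rightarrow> complex" where
  "bordered R w \<tau> (Some i) (Some j) = R i j"
| "bordered R w \<tau> (Some i) None = w i"
| "bordered R w \<tau> None (Some j) = cnj (w j)"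
| "bordered R w \<tau> None None = complex_of_real \<tau>"

definition freqs :: "nat \<Rightarrow> (int ^ 'd) set" where
  "freqs l = {k. \<forall>i. k $ i \<in> {- int l..int l}}"

definition generalized_toeplitz :: "nat \<Rightarrow> (int ^ 'd \<Rightarrow> int ^ 'd \<Rightarrow> complex) \<Rightarrow> bool" where
  "generalized_toeplitz l R \<longleftrightarrow>
     (\<forall>i\<in>freqs l. \<forall>j\<in>freqs l. \<forall>k\<in>freqs l.
        i + k \<in> freqs l \<longrightarrow> j + k \<in> freqs l \<longrightarrow> R (i + k) (j + k) = R i j)"

text \<open>Optimal values are infima in the extended reals. Vectors and matrices over a frequency set
  are functions on \<open>\<int>\<^sup>d\<close> of which only the entries in that set matter.\<close>

definition Q0_value :: "nat \<Rightarrow> (int ^ 'd::finite \<Rightarrow> complex) \<Rightarrow> ereal" where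
  "Q0_value fc z = Inf {enn2ereal (variation \<mu> UNIV) | \<mu> :: 'd torus set \<Rightarrow> complex.
     bounded_radon_measure \<mu> \<and> (\<forall>k\<in>freqs fc. fourier_coeff \<mu> k = z k)}"

definition Q0_relaxed_value :: "nat \<Rightarrow> (int ^ 'd::finite \<Rightarrow> complex) \<Rightarrow> nat \<Rightarrow> ereal" where
  "Q0_relaxed_value fc z l =
     Inf {ereal (1 / 2 * (1 / real ((2 * l + 1) ^ CARD('d)) * Re (\<Sum>i\<in>freqs l. R i i) + \<tau>)) |
       (R :: int ^ 'd \<Rightarrow> int ^ 'd \<Rightarrow> complex) (w :: int ^ 'd \<Rightarrow> complex) (\<tau> :: real).
         psd_on (freqs l) R \<and>
         psd_on (insert None (Some ` freqs l)) (bordered R w \<tau>) \<and>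
         (\<forall>k\<in>freqs fc. w k = z k) \<and>
         generalized_toeplitz l R}"

end

theory Submission
  imports Defs "HOL-Real_Asymp.Real_Asymp"
begin

text \<open>A Toeplitz matrix has constant diagonal, so the objective of the relaxation of level \<open>l\<close> is
  \<open>(R\<^sub>0\<^sub>0 + \<tau>) / 2\<close>. The relaxations are therefore nested: cutting a feasible point of a higher
  level down to the smaller index set keeps it feasible with the same objective
  (\<open>Q0_relaxed_value_mono\<close>).

  A complex measure \<open>\<mu>\<close> with the prescribed coefficients gives a feasible point of value at most
  \<open>|\<mu>| + \<eta>\<close> for every \<open>\<eta> > 0\<close> (\<open>Q0_relaxed_value_le_variation\<close>). In principle one takes
  the moment matrix of \<open>|\<mu>|\<close> and \<open>\<tau> = |\<mu>|\<close>. Here the polar decomposition of \<open>\<mu>\<close> is avoided: the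
  torus is cut into finitely many Borel cells on which all characters of the level are nearly constant,
  \<open>\<mu>\<close> is concentrated at one sample point per cell, and the small error in the Fourier
  coefficients is absorbed by adding \<open>\<eta>\<close> to the diagonal of the bordered matrix.

  The converse inequality holds up to an error that tends to zero with the level
  (\<open>Q0_value_le_relaxed\<close>), without compactness arguments. Let \<open>(R, w, \<tau>)\<close> be feasible. If \<open>R\<close> were
  the moment matrix of a positive measure \<open>\<rho>\<close> and \<open>R a = z\<close> on the prescribed
  frequencies, then the polynomial \<open>A = \<Sum> a\<^sub>j e\<^sub>-\<^sub>j\<close> would give a measure \<open>A \<rho>\<close> with coefficients
  \<open>z\<close>, and its norm \<open>\<integral>|A| d\<rho>\<close> would be at most
  \<open>(\<rho>(1) + \<integral>|A|\<^sup>2 d\<rho>) / 2 = (R\<^sub>0\<^sub>0 + a\<^sup>* R a) / 2 \<le> (R\<^sub>0\<^sub>0 + \<tau>) / 2\<close>. Three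
  approximations make this rigorous. The measure \<open>\<rho>\<close> is replaced by the nonnegative Fejer
  polynomial of \<open>R\<close> (\<open>toeplitz_density\<close>), whose coefficients are those of \<open>R\<close> times weights
  that tend to 1. The system is regularized to \<open>(R + \<delta>) a = z\<close>, which bounds \<open>a\<close> independently
  of \<open>R\<close> (\<open>ridge_solution_bound\<close>). The remaining small error in the coefficients is
  corrected by a trigonometric polynomial with small coefficients. As all densities are trigonometric
  polynomials of bounded degree, the Haar measure can be replaced by the uniform measure on a fine
  grid (\<open>torus_quadrature\<close>), so that the final measure is a finite combination of point masses.\<close>

section \<open>Frequency sets and positive semidefinite matrices\<close>

lemma freqs_eq_image: "(freqs l :: (int ^ 'd::finite) set) = vec_lambda ` (UNIV \<rightarrow>\<^sub>E {- int l..int l})"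
proof -
  have "k \<in> vec_lambda ` (UNIV \<rightarrow>\<^sub>E {- int l..int l})" if "k \<in> freqs l" for k :: "int ^ 'd"
    using that by (intro image_eqI[of _ _ "vec_nth k"]) (auto simp: freqs_def)
  then show ?thesis by (auto simp: freqs_def PiE_def Pi_def)
qed

lemma finite_freqs [simp]: "finite (freqs l :: (int ^ 'd::finite) set)"
  unfolding freqs_eq_image by (intro finite_imageI finite_PiE) auto

lemma card_freqs: "card (freqs l :: (int ^ 'd::finite) set) = (2 * l + 1) ^ CARD('d)"
proof -
  have "inj_on vec_lambda (UNIV \<rightarrow>\<^sub>E {- int l..int l} :: ('d \<Rightarrow> int) set)"
    by (auto simp: inj_on_def vec_lambda_inject)
  then show ?thesis
    unfolding freqs_eq_image by (simp add: card_image card_PiE nat_add_distrib nat_mult_distrib)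
qed

lemma zero_in_freqs [simp]: "0 \<in> freqs l"
  by (simp add: freqs_def)

lemma freqs_iff_abs_le: "k \<in> freqs l \<longleftrightarrow> (\<forall>i. \<bar>k $ i\<bar> \<le> int l)"
  by (auto simp: freqs_def abs_le_iff minus_le_iff)

lemma freqs_mono: "l \<le> l' \<Longrightarrow> freqs l \<subseteq> freqs l'"
  by (auto simp: freqs_iff_abs_le) (meson of_nat_le_iff order_trans)

lemma freqs_add: "i \<in> freqs l \<Longrightarrow> j \<in> freqs l' \<Longrightarrow> i + j \<in> freqs (l + l')"
  by (auto simp: freqs_iff_abs_le intro: order_trans[OF abs_triangle_ineq add_mono])

lemma freqs_diff: "i \<in> freqs l \<Longrightarrow> j \<in> freqs l' \<Longrightarrow> i - j \<in> freqs (l + l')"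
  by (auto simp: freqs_iff_abs_le intro: order_trans[OF abs_triangle_ineq4 add_mono])

abbreviation quad_form :: "'i set \<Rightarrow> ('i \<Rightarrow> 'i \<Rightarrow> complex) \<Rightarrow> ('i \<Rightarrow> complex) \<Rightarrow> complex" where
  "quad_form I A v \<equiv> (\<Sum>i\<in>I. \<Sum>j\<in>I. cnj (v i) * A i j * v j)"

lemma psd_onD: "psd_on I A \<Longrightarrow> 0 \<le> Re (quad_form I A v)"
  unfolding psd_on_def by blast

lemma psd_on_hermitian: "psd_on I A \<Longrightarrow> hermitian_on I A"
  unfolding psd_on_def by (rule conjunct1)

lemma hermitian_onD: "hermitian_on I A \<Longrightarrow> i \<in> I \<Longrightarrow> j \<in> I \<Longrightarrow> A j i = cnj (A i j)"
  unfolding hermitian_on_def by (drule (1) bspec, drule (1) bspec, assumption)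

lemma psd_on_quad_form_real:
  assumes "psd_on I A"
  shows "quad_form I A v = of_real (Re (quad_form I A v))"
proof -
  have "cnj (quad_form I A v) = (\<Sum>i\<in>I. \<Sum>j\<in>I. v i * cnj (A i j) * cnj (v j))"
    by (simp add: cnj_sum)
  also have "\<dots> = (\<Sum>i\<in>I. \<Sum>j\<in>I. v i * A j i * cnj (v j))"
    by (intro sum.cong refl arg_cong2[where f = "(*)"])
       (rule hermitian_onD[OF psd_on_hermitian[OF assms], symmetric])
  also have "\<dots> = quad_form I A v"
    by (subst sum.swap) (simp add: mult_ac)
  finally have "quad_form I A v \<in> \<real>"
    by (simp only: Reals_cnj_iff)
  then show ?thesis
    by (rule of_real_Re[symmetric])
qed

lemma quad_form_mono_neutral:
  assumes "finite I" "J \<subseteq> I" "\<And>i. i \<in> I - J \<Longrightarrow> v i = 0"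
  shows "quad_form I A v = quad_form J A v"
proof -
  have "quad_form I A v = (\<Sum>i\<in>J. \<Sum>j\<in>I. cnj (v i) * A i j * v j)"
    using assms by (intro sum.mono_neutral_right) auto
  also have "\<dots> = quad_form J A v"
    using assms by (intro sum.cong refl sum.mono_neutral_right) auto
  finally show ?thesis .
qed

text \<open>A vector on the smaller index set, extended by zero, has the same quadratic form.\<close>

lemma psd_on_subset:
  assumes "finite I" "J \<subseteq> I" "psd_on I A"
  shows "psd_on J A"
  unfolding psd_on_def
proof (intro conjI allI)
  show "hermitian_on J A"
    using psd_on_hermitian[OF assms(3)] assms(2) unfolding hermitian_on_def by blast
next
  fix v :: "'a \<Rightarrow> complex"
  let ?v = "\<lambda>i. if i \<in> J then v i else 0"
  have "0 \<le> Re (quad_form I A ?v)"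
    using assms(3) by (rule psd_onD)
  also have "quad_form I A ?v = quad_form J A ?v"
    using assms by (intro quad_form_mono_neutral) auto
  also have "\<dots> = quad_form J A v"
    by (intro sum.cong refl) auto
  finally show "0 \<le> Re (quad_form J A v)" .
qed

lemma psd_on_diag_nonneg:
  assumes "finite I" "psd_on I A" "i \<in> I"
  shows "0 \<le> Re (A i i)" and "Im (A i i) = 0"
proof -
  have "psd_on {i} A"
    by (rule psd_on_subset[of I]) (use assms in auto)
  from psd_onD[OF this, of "\<lambda>_. 1"] psd_on_quad_form_real[OF this, of "\<lambda>_. 1"]
  show "0 \<le> Re (A i i)" "Im (A i i) = 0"
    by (auto simp: complex_eq_iff)
qed

text \<open>The form is nonnegative at the vector that is \<open>1\<close> at \<open>j\<close> and has at \<open>i\<close> the phase that turns the off-diagonal term into \<open>- |A\<^sub>i\<^sub>j|\<close>.\<close>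

lemma psd_on_entry_bound:
  assumes "finite I" "psd_on I A" "i \<in> I" "j \<in> I"
  shows "cmod (A i j) \<le> (Re (A i i) + Re (A j j)) / 2"
proof (cases "i = j")
  case True
  then show ?thesis
    using psd_on_diag_nonneg[OF assms(1-3)] by (simp add: cmod_def)
next
  case False
  have psd: "psd_on {i, j} A"
    by (rule psd_on_subset[of I]) (use assms in auto)
  define u where "u = - sgn (A i j)"
  have u: "cnj u * A i j = - of_real (cmod (A i j))"
  proof (cases "A i j = 0")
    case False
    have "cnj (A i j) * A i j = of_real (cmod (A i j)) * of_real (cmod (A i j))"
      by (metis complex_norm_square mult.commute of_real_mult power2_eq_square)
    with False show ?thesis
      by (simp add: u_def sgn_eq)
  qed (simp add: u_def)
  have herm: "A j i = cnj (A i j)"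
    by (rule hermitian_onD[OF psd_on_hermitian[OF assms(2)] assms(3,4)])
  have nu: "cmod u \<le> 1" by (simp add: u_def norm_sgn)
  have "0 \<le> Re (quad_form {i, j} A (\<lambda>k. if k = i then u else 1))"
    using psd by (rule psd_onD)
  also have "quad_form {i, j} A (\<lambda>k. if k = i then u else 1)
      = cnj u * A i i * u + cnj u * A i j + (A j i * u + A j j)"
    using False by simp
  also have "A j i * u = cnj (cnj u * A i j)"
    by (simp add: herm)
  also have "cnj u * A i i * u = of_real ((cmod u)\<^sup>2) * A i i"
    by (simp only: complex_norm_square) (simp add: mult_ac)
  finally have "0 \<le> (cmod u)\<^sup>2 * Re (A i i) - 2 * cmod (A i j) + Re (A j j)"
    by (simp add: u)
  moreover have "(cmod u)\<^sup>2 * Re (A i i) \<le> 1 * Re (A i i)"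
    using psd_on_diag_nonneg(1)[OF assms(1-3)] nu
    by (intro mult_right_mono) (auto simp: power_le_one)
  ultimately show ?thesis by simp
qed

lemma hermitian_on_bordered:
  assumes "hermitian_on I R"
  shows "hermitian_on (insert None (Some ` I)) (bordered R w \<tau>)"
  unfolding hermitian_on_def
proof (intro ballI)
  fix x y
  assume "x \<in> insert None (Some ` I)" "y \<in> insert None (Some ` I)"
  then show "bordered R w \<tau> y x = cnj (bordered R w \<tau> x y)"
  proof (cases x; cases y)
    fix i j
    assume "x \<in> insert None (Some ` I)" "y \<in> insert None (Some ` I)" "x = Some i" "y = Some j"
    then have "i \<in> I" "j \<in> I" by auto
    then have "R j i = cnj (R i j)"
      by (rule hermitian_onD[OF assms])
    then show ?thesis
      unfolding \<open>x = Some i\<close> \<open>y = Some j\<close> bordered.simps .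
  qed auto
qed

lemma Re_quad_form_bordered:
  assumes "finite I"
  shows "Re (quad_form (insert None (Some ` I)) (bordered R w \<tau>) v)
    = Re (quad_form I R (v \<circ> Some)) + 2 * Re (v None * (\<Sum>i\<in>I. cnj (v (Some i)) * w i)) + \<tau> * (cmod (v None))\<^sup>2"
proof -
  define S where "S = (\<Sum>i\<in>I. cnj (v (Some i)) * w i)"
  have sum_opt: "(\<Sum>i\<in>insert None (Some ` I). f i) = f None + (\<Sum>i\<in>I. f (Some i))" for f :: "_ \<Rightarrow> complex"
    using assms by (subst sum.insert) (auto simp: sum.reindex)
  have "quad_form (insert None (Some ` I)) (bordered R w \<tau>) v
      = cnj (v None) * of_real \<tau> * v None + (\<Sum>j\<in>I. cnj (v None) * cnj (w j) * v (Some j))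
        + ((\<Sum>i\<in>I. cnj (v (Some i)) * w i * v None) + quad_form I R (v \<circ> Some))"
    by (simp add: sum_opt sum.distrib)
  also have "(\<Sum>j\<in>I. cnj (v None) * cnj (w j) * v (Some j)) = cnj (v None * S)"
    by (simp add: S_def sum_distrib_left mult_ac)
  also have "(\<Sum>i\<in>I. cnj (v (Some i)) * w i * v None) = v None * S"
    by (simp add: S_def sum_distrib_left mult_ac)
  also have "cnj (v None) * of_real \<tau> * v None = of_real (\<tau> * (cmod (v None))\<^sup>2)"
    by (simp only: of_real_mult complex_norm_square) (simp add: mult_ac)
  finally show ?thesis
    unfolding S_def[symmetric] by simp
qed

text \<open>Block elimination: the row of the new index \<open>p\<close> is solved last, and its pivot is the Schur
  complement \<open>s\<close>. The vector \<open>v\<close> with entry \<open>1\<close> at \<open>p\<close> and \<open>- u\<close> elsewhere exhibits \<open>s\<close> as the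
  value at \<open>v\<close> of the form of \<open>A + \<delta>\<close>, so the real part of \<open>s\<close> is at least \<open>\<delta>\<close>.\<close>

lemma ridge_system_solvable:
  assumes "finite I" "psd_on I A" "0 < \<delta>"
  shows "\<exists>a. \<forall>i\<in>I. (\<Sum>j\<in>I. A i j * a j) + of_real \<delta> * a i = z i"
  using assms(1,2)
proof (induction I arbitrary: z rule: finite_induct)
  case empty
  then show ?case by simp
next
  case (insert p I)
  have psd: "psd_on I A"
    by (rule psd_on_subset[of "insert p I"]) (use insert in auto)
  obtain a where a: "\<And>i. i \<in> I \<Longrightarrow> (\<Sum>j\<in>I. A i j * a j) + of_real \<delta> * a i = z i"
    using insert.IH[OF psd, of z] by blast
  obtain u where u: "\<And>i. i \<in> I \<Longrightarrow> (\<Sum>j\<in>I. A i j * u j) + of_real \<delta> * u i = A i p"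
    using insert.IH[OF psd, of "\<lambda>i. A i p"] by blast
  define s where "s = A p p + of_real \<delta> - (\<Sum>j\<in>I. A p j * u j)"
  define v where "v = (\<lambda>i. if i = p then 1 else - u i)"
  have vI: "v i = - u i" if "i \<in> I" for i
    using that insert.hyps by (auto simp: v_def)
  have row: "(\<Sum>j\<in>insert p I. A i j * v j) = (if i = p then s - of_real \<delta> else of_real \<delta> * u i)"
    if "i \<in> insert p I" for i
  proof -
    have "(\<Sum>j\<in>insert p I. A i j * v j) = A i p - (\<Sum>j\<in>I. A i j * u j)"
      using insert.hyps by (simp add: v_def[THEN fun_cong, of p] vI sum_negf)
    moreover have "(\<Sum>j\<in>I. A i j * u j) = A i p - of_real \<delta> * u i" if "i \<in> I"
      using u[OF that] by (simp add: eq_diff_eq)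
    ultimately show ?thesis
      using that by (auto simp: s_def)
  qed
  have "quad_form (insert p I) A v = (\<Sum>i\<in>insert p I. cnj (v i) * (\<Sum>j\<in>insert p I. A i j * v j))"
    by (simp only: sum_distrib_left mult.assoc)
  also have "\<dots> = (\<Sum>i\<in>insert p I. cnj (v i) * (if i = p then s - of_real \<delta> else of_real \<delta> * u i))"
    by (intro sum.cong refl arg_cong2[where f = "(*)"] row)
  also have "\<dots> = s - of_real \<delta> + (\<Sum>i\<in>I. cnj (v i) * (if i = p then s - of_real \<delta> else of_real \<delta> * u i))"
    using insert.hyps by (simp add: v_def)
  also have "(\<Sum>i\<in>I. cnj (v i) * (if i = p then s - of_real \<delta> else of_real \<delta> * u i))
      = (\<Sum>i\<in>I. of_real (- \<delta> * (cmod (u i))\<^sup>2))"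
  proof (intro sum.cong refl)
    fix i assume i: "i \<in> I"
    then have "i \<noteq> p" using insert.hyps by auto
    then have "cnj (v i) * (if i = p then s - of_real \<delta> else of_real \<delta> * u i) = of_real (- \<delta>) * (u i * cnj (u i))"
      by (simp add: vI[OF i])
    then show "cnj (v i) * (if i = p then s - of_real \<delta> else of_real \<delta> * u i) = of_real (- \<delta> * (cmod (u i))\<^sup>2)"
      by (simp only: complex_norm_square of_real_mult)
  qed
  finally have "Re s = Re (quad_form (insert p I) A v) + \<delta> + (\<Sum>i\<in>I. \<delta> * (cmod (u i))\<^sup>2)"
    by (simp add: sum_negf)
  then have "Re s > 0"
    using psd_onD[OF insert.prems, of v] assms(3) sum_nonneg[of I "\<lambda>i. \<delta> * (cmod (u i))\<^sup>2"]
    by simp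
  then have "s \<noteq> 0" by auto
  define c where "c = (z p - (\<Sum>j\<in>I. A p j * a j)) / s"
  define b where "b = (\<lambda>i. if i = p then c else a i - c * u i)"
  have bI: "b i = a i - c * u i" if "i \<in> I" for i
    using that insert.hyps by (auto simp: b_def)
  have sum_b: "(\<Sum>j\<in>insert p I. A i j * b j) = A i p * c + (\<Sum>j\<in>I. A i j * a j) - c * (\<Sum>j\<in>I. A i j * u j)" for i
  proof -
    have "(\<Sum>j\<in>insert p I. A i j * b j) = A i p * c + (\<Sum>j\<in>I. A i j * b j)"
      using insert.hyps by (simp add: b_def)
    also have "(\<Sum>j\<in>I. A i j * b j) = (\<Sum>j\<in>I. A i j * a j - c * (A i j * u j))"
      by (intro sum.cong refl) (simp add: bI algebra_simps)
    finally show ?thesis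
      by (simp add: sum_subtractf sum_distrib_left)
  qed
  have "(\<Sum>j\<in>insert p I. A i j * b j) + of_real \<delta> * b i = z i" if "i \<in> insert p I" for i
  proof (cases "i = p")
    case True
    have "c * s = z p - (\<Sum>j\<in>I. A p j * a j)"
      using \<open>s \<noteq> 0\<close> by (simp add: c_def)
    then have "c * A p p + c * of_real \<delta> - c * (\<Sum>j\<in>I. A p j * u j) = z p - (\<Sum>j\<in>I. A p j * a j)"
      by (simp add: s_def algebra_simps)
    then show ?thesis
      unfolding True sum_b by (simp add: b_def algebra_simps)
  next
    case False
    then have i: "i \<in> I" using that by auto
    have "(\<Sum>j\<in>insert p I. A i j * b j) + of_real \<delta> * b i
       = ((\<Sum>j\<in>I. A i j * a j) + of_real \<delta> * a i) + c * (A i p - ((\<Sum>j\<in>I. A i j * u j) + of_real \<delta> * u i))"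
      unfolding sum_b bI[OF i] by (simp add: algebra_simps)
    then show ?thesis
      by (simp add: a[OF i] u[OF i])
  qed
  then show ?case by blast
qed

text \<open>Evaluate the bordered form at \<open>a\<close> with last entry \<open>- 1\<close>. The linear term is
  \<open>- 2 Re (a\<^sup>* z)\<close>, and \<open>a\<^sup>* z = a\<^sup>* R a + \<delta> |a|\<^sup>2\<close> by the equations for \<open>a\<close>. The estimate of
  \<open>|a|\<^sup>2\<close> depends on \<open>\<tau>\<close> and \<open>\<delta>\<close> only, however singular \<open>R\<close> is.\<close>

lemma ridge_solution_bound:
  fixes z :: "'i \<Rightarrow> complex"
  assumes "finite I" "psd_on (insert None (Some ` I)) (bordered R z \<tau>)"
    and a: "\<And>i. i \<in> I \<Longrightarrow> (\<Sum>j\<in>I. R i j * a j) + of_real \<delta> * a i = z i"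
  shows "Re (quad_form I R a) + 2 * \<delta> * (\<Sum>i\<in>I. (cmod (a i))\<^sup>2) \<le> \<tau>"
proof -
  define v where "v = (\<lambda>i. case i of None \<Rightarrow> - 1 | Some i \<Rightarrow> a i)"
  have v_simps: "v None = - 1" "v (Some i) = a i" "v \<circ> Some = a" for i
    by (auto simp: v_def)
  have "(\<Sum>i\<in>I. cnj (a i) * z i) = (\<Sum>i\<in>I. cnj (a i) * ((\<Sum>j\<in>I. R i j * a j) + of_real \<delta> * a i))"
    by (intro sum.cong refl) (simp add: a)
  also have "\<dots> = quad_form I R a + (\<Sum>i\<in>I. of_real (\<delta> * (cmod (a i))\<^sup>2))"
    by (simp only: of_real_mult complex_norm_square)
       (simp add: distrib_left sum.distrib sum_distrib_left mult_ac)
  finally have "Re (\<Sum>i\<in>I. cnj (a i) * z i) = Re (quad_form I R a) + \<delta> * (\<Sum>i\<in>I. (cmod (a i))\<^sup>2)"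
    by (simp add: sum_distrib_left)
  moreover have "0 \<le> Re (quad_form I R a) + 2 * Re (- (\<Sum>i\<in>I. cnj (a i) * z i)) + \<tau>"
    using psd_onD[OF assms(2), of v] unfolding Re_quad_form_bordered[OF assms(1)]
    by (simp only: v_simps mult_minus1 norm_minus_cancel norm_one one_power2 mult_1_right)
  ultimately show ?thesis by simp
qed

lemma relaxed_objective_eq:
  assumes "generalized_toeplitz l (R :: int ^ 'd::finite \<Rightarrow> int ^ 'd \<Rightarrow> complex)"
  shows "1 / real ((2 * l + 1) ^ CARD('d)) * Re (\<Sum>i\<in>freqs l. R i i) = Re (R 0 0)"
proof -
  have "R i i = R 0 0" if "i \<in> freqs l" for i
    using assms that unfolding generalized_toeplitz_def
    by (metis add_0 zero_in_freqs)
  then have "(\<Sum>i\<in>freqs l. R i i) = (\<Sum>i\<in>(freqs l :: (int ^ 'd) set). R 0 0)"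
    by (intro sum.cong refl)
  moreover have "Re (of_nat n * x) = real n * Re x" for n x
    by simp
  ultimately have "Re (\<Sum>i\<in>freqs l. R i i) = real ((2 * l + 1) ^ CARD('d)) * Re (R 0 0)"
    by (simp only: sum_constant card_freqs)
  then show ?thesis
    by (simp del: of_nat_power)
qed

definition relaxed_feasible where
  "relaxed_feasible fc z l R w \<tau> \<longleftrightarrow> psd_on (freqs l) R \<and>
         psd_on (insert None (Some ` freqs l)) (bordered R w \<tau>) \<and>
         (\<forall>k\<in>freqs fc. w k = z k) \<and> generalized_toeplitz l R"

lemma Q0_relaxed_value_eq:
  "Q0_relaxed_value fc (z :: int ^ 'd::finite \<Rightarrow> complex) l
    = Inf {ereal ((Re (R 0 0) + \<tau>) / 2) | R w \<tau>. relaxed_feasible fc z l R w \<tau>}"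
proof -
  have "ereal (1 / 2 * (1 / real ((2 * l + 1) ^ CARD('d)) * Re (\<Sum>i\<in>freqs l. R i i) + \<tau>)) =
      ereal ((Re (R 0 0) + \<tau>) / 2)" if "relaxed_feasible fc z l R w \<tau>" for R w \<tau>
    using relaxed_objective_eq[of l R] that by (simp add: relaxed_feasible_def)
  then show ?thesis
    unfolding Q0_relaxed_value_def relaxed_feasible_def[symmetric]
    by (intro arg_cong[where f = Inf] Collect_cong iff_exI rev_conj_cong refl) (simp only:)
qed

lemma relaxed_feasible_restrict:
  assumes "relaxed_feasible fc z l' R w \<tau>" "l \<le> l'"
  shows "relaxed_feasible fc (z :: int ^ 'd::finite \<Rightarrow> complex) l R w \<tau>"
proof -
  have sub: "(freqs l :: (int ^ 'd) set) \<subseteq> freqs l'"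
    using assms(2) by (rule freqs_mono)
  have "psd_on (insert None (Some ` freqs l)) (bordered R w \<tau>)"
    by (rule psd_on_subset[of "insert None (Some ` freqs l')"]) (use assms sub in \<open>auto simp: relaxed_feasible_def\<close>)
  moreover have "psd_on (freqs l) R"
    by (rule psd_on_subset[of "freqs l'"]) (use assms sub in \<open>auto simp: relaxed_feasible_def\<close>)
  moreover have "generalized_toeplitz l R"
    using assms(1) sub unfolding relaxed_feasible_def generalized_toeplitz_def by blast
  ultimately show ?thesis
    using assms(1) by (auto simp: relaxed_feasible_def)
qed

lemma Q0_relaxed_value_mono:
  assumes "l \<le> l'"
  shows "Q0_relaxed_value fc (z :: int ^ 'd::finite \<Rightarrow> complex) l \<le> Q0_relaxed_value fc z l'"
  unfolding Q0_relaxed_value_eq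
  by (rule Inf_superset_mono) (use assms relaxed_feasible_restrict in blast)

section \<open>Characters of the torus and a quadrature rule\<close>

lemma torus_char_add: "torus_char (j + k) x = torus_char j x * torus_char k x"
  by transfer (simp add: exp_add[symmetric] algebra_simps sum.distrib)

lemma torus_char_0 [simp]: "torus_char 0 x = 1"
  by transfer simp

lemma torus_char_uminus: "torus_char (- k) x = cnj (torus_char k x)"
  by transfer (simp add: exp_cnj sum_negf)

lemma torus_char_diff: "torus_char (j - k) x = torus_char j x * cnj (torus_char k x)"
  using torus_char_add[of j "- k" x] by (simp add: torus_char_uminus)

lemma norm_torus_char [simp]: "cmod (torus_char k x) = 1"
  by transfer (simp add: norm_exp_eq_Re)

lemma continuous_on_torus_char: "continuous_on UNIV (torus_char k)"
proof -
  have "open (torus_char k -` U)" if "open U" for U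
  proof -
    have "continuous_on UNIV (\<lambda>y. torus_char k (abs_torus y))"
      unfolding torus_char.abs_eq by (intro continuous_intros)
    then have "open ((\<lambda>y. torus_char k (abs_torus y)) -` U)"
      using that by (simp add: continuous_on_open_vimage)
    then show ?thesis
      by (simp add: open_torus_def vimage_comp comp_def)
  qed
  then show ?thesis
    by (simp add: continuous_on_open_vimage)
qed

lemma borel_measurable_torus_char [measurable]: "torus_char k \<in> borel_measurable borel"
  by (rule borel_measurable_continuous_onI[OF continuous_on_torus_char])

text \<open>The preimage of a point in \<open>\<real>\<^sup>d\<close> is a translate of the closed lattice \<open>\<int>\<^sup>d\<close>.\<close>

lemma closed_torus_point: "closed {x :: 'd::finite torus}"
proof -
  obtain y where y: "x = abs_torus y"
    by (metis Quotient3_abs_rep Quotient3_torus)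
  have "abs_torus -` {x} = {u. \<forall>i. u $ i - y $ i \<in> \<int>}"
    by (auto simp: y torus.abs_eq_iff int_translate_def)
  moreover have "closed {u :: real ^ 'd. u $ i - y $ i \<in> \<int>}" for i
  proof -
    have "closed ((\<lambda>u :: real ^ 'd. u $ i - y $ i) -` \<int>)"
      by (intro closed_vimage closed_Ints continuous_intros)
    then show ?thesis by (simp add: vimage_def)
  qed
  ultimately have "closed (abs_torus -` {x})"
    by (simp add: closed_Collect_all)
  then show ?thesis
    by (simp add: closed_def open_torus_def vimage_Compl)
qed

lemma roots_of_unity_sum:
  fixes k :: int
  assumes "\<bar>k\<bar> < int M"
  shows "(\<Sum>t<M. exp (- (2 * \<i> * complex_of_real pi * complex_of_real (real_of_int k * (real t / real M)))))
    = (if k = 0 then of_nat M else 0)"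
proof -
  define \<omega> where "\<omega> = exp (- (2 * \<i> * complex_of_real pi * complex_of_real (real_of_int k / real M)))"
  have M: "M > 0" using assms by auto
  have pow: "exp (- (2 * \<i> * complex_of_real pi * complex_of_real (real_of_int k * (real t / real M)))) = \<omega> ^ t" for t
    unfolding \<omega>_def exp_of_nat_mult[symmetric] by (simp add: algebra_simps)
  have "\<omega> ^ M = exp (- (2 * \<i> * complex_of_real pi * complex_of_real (real_of_int k)))"
    using M unfolding \<omega>_def exp_of_nat_mult[symmetric] by (simp add: algebra_simps)
  also have "\<dots> = 1"
    by (auto simp: exp_eq_1 intro!: exI[of _ "- k"])
  finally have "\<omega> ^ M = 1" .
  moreover have "\<omega> \<noteq> 1" if "k \<noteq> 0"
  proof
    assume "\<omega> = 1"
    then obtain n :: int where "- (2 * pi * (real_of_int k / real M)) = of_int (2 * n) * pi"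
      by (auto simp: \<omega>_def exp_eq_1)
    then have "pi * real_of_int k = pi * (- real_of_int n * real M)"
      using M by (simp add: field_simps)
    then have "real_of_int k = - real_of_int n * real M"
      by (simp only: mult_cancel_left pi_neq_zero) simp
    then have "real_of_int k = real_of_int (- n * int M)"
      by simp
    then have "k = - n * int M"
      by (simp only: of_int_eq_iff)
    then have "int M dvd k" by simp
    with assms that show False
      using zdvd_imp_le[of "int M" "\<bar>k\<bar>"] by simp
  qed
  moreover have "\<omega> = 1" if "k = 0"
    using that by (simp add: \<omega>_def)
  ultimately show ?thesis
    unfolding pow by (auto simp: sum_gp_strict geometric_sum)
qed

text \<open>On the grid of points with coordinates in \<open>{0, 1/M, \<dots>, (M - 1)/M}\<close> the sum of a character
  factors into sums of \<open>M\<close>-th roots of unity, which vanish for nonzero frequencies below \<open>M\<close>.\<close>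

lemma torus_quadrature:
  obtains G :: "('d::finite \<Rightarrow> nat) set" and x :: "('d::finite \<Rightarrow> nat) \<Rightarrow> 'd torus"
  where "finite G" "G \<noteq> {}"
    "\<And>k. k \<in> freqs L \<Longrightarrow> (\<Sum>g\<in>G. torus_char k (x g)) / of_nat (card G) = (if k = 0 then 1 else 0)"
proof -
  define M where "M = L + 1"
  define G where "G = (UNIV :: 'd set) \<rightarrow>\<^sub>E {..<M}"
  define x where "x = (\<lambda>g :: 'd \<Rightarrow> nat. abs_torus (\<chi> i. real (g i) / real M))"
  have fin: "finite G"
    unfolding G_def by (intro finite_PiE) auto
  have ne: "G \<noteq> {}"
    by (simp add: G_def PiE_eq_empty_iff M_def lessThan_empty_iff)
  have cG: "card G = M ^ CARD('d)"
    unfolding G_def by (simp add: card_PiE)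
  have "(\<Sum>g\<in>G. torus_char k (x g)) / of_nat (card G) = (if k = 0 then 1 else 0)" if k: "k \<in> freqs L" for k
  proof -
    have "torus_char k (x g) = (\<Prod>i\<in>UNIV. exp (- (2 * \<i> * complex_of_real pi * complex_of_real (real_of_int (k $ i) * (real (g i) / real M)))))" for g
      unfolding x_def torus_char.abs_eq by (simp add: exp_sum[symmetric] sum_negf sum_distrib_left)
    then have "(\<Sum>g\<in>G. torus_char k (x g)) = (\<Prod>i\<in>UNIV. \<Sum>t<M. exp (- (2 * \<i> * complex_of_real pi * complex_of_real (real_of_int (k $ i) * (real t / real M)))))"
      unfolding G_def by (subst prod_sum_PiE) auto
    also have "\<dots> = (\<Prod>i\<in>UNIV. if k $ i = 0 then of_nat M else 0)"
      using k by (intro prod.cong refl roots_of_unity_sum) (auto simp: freqs_iff_abs_le M_def intro: le_less_trans)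
    also have "\<dots> = (if k = 0 then of_nat (card G) else 0)"
    proof (cases "k = 0")
      case False
      then obtain i where "k $ i \<noteq> 0" by (auto simp: vec_eq_iff)
      then show ?thesis
        using False by (subst prod_zero) auto
    qed (simp add: cG)
    finally show ?thesis
      using fin ne by simp
  qed
  with fin ne show ?thesis by (rule that)
qed

section \<open>Jordan parts and sampling of complex measures\<close>

lemma simple_function_borel_vimage:
  "simple_function borel \<pi> \<Longrightarrow> \<pi> -` X \<in> sets borel"
  using simple_functionD(2)[of borel \<pi> X] by simp

lemma simple_function_borel_finite_range: "simple_function borel \<pi> \<Longrightarrow> finite (range \<pi>)"
  using simple_functionD(1)[of borel \<pi>] by simp

text \<open>A simple function cuts the space into finitely many Borel fibres; padded with empty sets they form one of the partitions in the definition of the variation.\<close>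

lemma sum_fibres_le_variation:
  fixes \<mu> :: "'a::topological_space set \<Rightarrow> complex"
  assumes \<pi>: "simple_function borel (\<pi> :: 'a \<Rightarrow> 'b)"
  shows "(\<Sum>p\<in>range \<pi>. ennreal (cmod (\<mu> (\<pi> -` {p})))) \<le> variation \<mu> UNIV"
proof -
  define N where "N = card (range \<pi>)"
  obtain h where h: "bij_betw h {0..<N} (range \<pi>)"
    using ex_bij_betw_nat_finite[OF simple_function_borel_finite_range[OF \<pi>]] by (auto simp: N_def)
  define E where "E n = (if n < N then \<pi> -` {h n} else {})" for n
  have "range E \<subseteq> sets borel"
    using simple_function_borel_vimage[OF \<pi>] by (auto simp: E_def)
  moreover have "disjoint_family E"
    using h by (auto simp: disjoint_family_on_def E_def bij_betw_def inj_on_def)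
  moreover have "(\<Union>n. E n) = UNIV"
  proof -
    have "\<exists>n<N. \<pi> x = h n" for x
      using bij_betw_imp_surj_on[OF h] by (metis atLeastLessThan_iff imageE rangeI)
    then show ?thesis by (force simp: E_def)
  qed
  ultimately have E: "(\<Sum>n. ennreal (cmod (\<mu> (E n)))) \<le> variation \<mu> UNIV"
    unfolding variation_def by (intro SUP_upper) auto
  have "(\<Sum>p\<in>range \<pi>. ennreal (cmod (\<mu> (\<pi> -` {p})))) = (\<Sum>n\<in>{0..<N}. ennreal (cmod (\<mu> (\<pi> -` {h n}))))"
    by (rule sum.reindex_bij_betw[OF h, symmetric])
  also have "\<dots> = (\<Sum>n\<in>{0..<N}. ennreal (cmod (\<mu> (E n))))"
    by (intro sum.cong) (auto simp: E_def)
  also have "\<dots> \<le> (\<Sum>n. ennreal (cmod (\<mu> (E n))))"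
    by (intro sum_le_suminf) auto
  finally show ?thesis using E by (rule order_trans)
qed

lemma complex_borel_measure_empty:
  assumes "complex_borel_measure \<mu>"
  shows "\<mu> {} = 0"
proof -
  have "(\<lambda>n :: nat. \<mu> {}) sums \<mu> (\<Union>n :: nat. {})"
    using assms unfolding complex_borel_measure_def
    by (elim allE[of _ "\<lambda>n. {}"]) (auto simp: disjoint_family_on_def)
  then have "(\<lambda>n :: nat. \<mu> {}) \<longlonglongrightarrow> 0"
    by (intro summable_LIMSEQ_zero sums_summable)
  then show ?thesis
    by (simp add: LIMSEQ_const_iff)
qed

lemma cmod_le_variation:
  fixes \<mu> :: "'a::topological_space set \<Rightarrow> complex"
  assumes "complex_borel_measure \<mu>" "A \<in> sets borel"
  shows "ennreal (cmod (\<mu> A)) \<le> variation \<mu> UNIV"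
proof (cases "A = {}")
  case True
  then show ?thesis by (simp add: complex_borel_measure_empty[OF assms(1)])
next
  case False
  have vimage: "(\<lambda>x. x \<in> A) -` {b} = (if b then A else - A)" for b
    by auto
  have sf: "simple_function borel (\<lambda>x. x \<in> A)"
    unfolding simple_function_def vimage using assms(2) by auto
  have "ennreal (cmod (\<mu> A)) = (\<Sum>b\<in>{True}. ennreal (cmod (\<mu> ((\<lambda>x. x \<in> A) -` {b}))))"
    by (simp add: vimage)
  also have "\<dots> \<le> (\<Sum>b\<in>range (\<lambda>x. x \<in> A). ennreal (cmod (\<mu> ((\<lambda>x. x \<in> A) -` {b}))))"
    using False by (intro sum_mono2 simple_function_borel_finite_range[OF sf]) (auto simp: image_iff)
  also have "\<dots> \<le> variation \<mu> UNIV"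
    by (rule sum_fibres_le_variation[OF sf])
  finally show ?thesis .
qed

locale bounded_signed_measure =
  fixes \<nu> :: "'a::topological_space set \<Rightarrow> real" and V :: real
  assumes sums: "range A \<subseteq> sets borel \<Longrightarrow> disjoint_family A \<Longrightarrow> (\<lambda>n :: nat. \<nu> (A n)) sums \<nu> (\<Union>n. A n)"
    and bound: "B \<in> sets borel \<Longrightarrow> \<bar>\<nu> B\<bar> \<le> V"
begin

lemma uminus: "bounded_signed_measure (\<lambda>A. - \<nu> A) V"
  by unfold_locales (auto intro: sums_minus sums simp: bound)

lemma empty: "\<nu> {} = 0"
proof -
  have "(\<lambda>n :: nat. \<nu> {}) sums \<nu> (\<Union>n :: nat. {})"
    by (rule sums) (auto simp: disjoint_family_on_def)
  then have "(\<lambda>n :: nat. \<nu> {}) \<longlonglongrightarrow> 0"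
    by (intro summable_LIMSEQ_zero sums_summable)
  then show ?thesis
    by (simp add: LIMSEQ_const_iff)
qed

lemma V_nonneg: "0 \<le> V"
  using bound[of "{}"] by (simp add: empty)

lemma Un:
  assumes "A \<in> sets borel" "B \<in> sets borel" "A \<inter> B = {}"
  shows "\<nu> (A \<union> B) = \<nu> A + \<nu> B"
proof -
  have "disjoint_family (binaryset A B)"
    using assms(3) by (auto simp: disjoint_family_on_def binaryset_def)
  then have "(\<lambda>n. \<nu> (binaryset A B n)) sums \<nu> (A \<union> B)"
    using sums[of "binaryset A B"] assms by (simp add: range_binaryset_eq UN_binaryset_eq)
  moreover have "(\<lambda>n. \<nu> (binaryset A B n)) sums (\<nu> A + \<nu> B)"
    by (rule binaryset_sums[of \<nu>, OF empty])
  ultimately show ?thesis by (rule sums_unique2)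
qed

text \<open>The set function from which the positive Jordan part is built.\<close>

definition upper :: "'a set \<Rightarrow> ennreal" where
  "upper A = (SUP B \<in> {B \<in> sets borel. B \<subseteq> A}. ennreal (\<nu> B))"

lemma le_upper: "B \<in> sets borel \<Longrightarrow> B \<subseteq> A \<Longrightarrow> ennreal (\<nu> B) \<le> upper A"
  unfolding upper_def by (intro SUP_upper) auto

lemma upper_mono: "A \<subseteq> A' \<Longrightarrow> upper A \<le> upper A'"
  unfolding upper_def by (rule SUP_subset_mono) auto

lemma upper_empty: "upper {} = 0"
proof -
  have "{B :: 'a set. B \<in> sets borel \<and> B \<subseteq> {}} = {{}}" by auto
  then show ?thesis by (simp add: upper_def empty)
qed

lemma upper_superadditive:
  assumes "A \<inter> A' = {}"
  shows "upper A + upper A' \<le> upper (A \<union> A')"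
proof -
  have "ennreal (\<nu> B) + ennreal (\<nu> B') \<le> upper (A \<union> A')"
    if "B \<in> sets borel" "B \<subseteq> A" "B' \<in> sets borel" "B' \<subseteq> A'" for B B'
  proof -
    have "ennreal (\<nu> B) \<le> upper (A \<union> A')" "ennreal (\<nu> B') \<le> upper (A \<union> A')"
      using that by (auto intro!: le_upper)
    moreover have "ennreal (\<nu> B + \<nu> B') \<le> upper (A \<union> A')"
      using that assms by (subst Un[symmetric]) (auto intro!: le_upper)
    ultimately show ?thesis
      by (cases "\<nu> B \<ge> 0"; cases "\<nu> B' \<ge> 0") (auto simp: ennreal_neg simp flip: ennreal_plus)
  qed
  moreover have ne: "{B \<in> sets borel. B \<subseteq> C} \<noteq> {}" for C :: "'a set"
    by auto
  ultimately show ?thesis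
    unfolding upper_def[of A] upper_def[of A'] ennreal_SUP_add_left[OF ne, symmetric] ennreal_SUP_add_right[OF ne]
    by (intro SUP_least) auto
qed

text \<open>Superadditivity gives one inequality. For the other, split a competitor \<open>B\<close> along the sets \<open>F n\<close>:
  \<open>\<nu> B\<close> is the sum of the \<open>\<nu> (B \<inter> F n)\<close>, and dropping the negative terms only increases it.\<close>

lemma upper_countably_additive: "countably_additive (sets borel) upper"
proof (rule countably_additiveI)
  fix F :: "nat \<Rightarrow> 'a set"
  assume F: "range F \<subseteq> sets borel" "disjoint_family F"
  show "(\<Sum>n. upper (F n)) = upper (\<Union>n. F n)"
  proof (rule antisym)
    have "(\<Sum>i<n. upper (F i)) \<le> upper (\<Union>i<n. F i)" for n
    proof (induction n)
      case (Suc n)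
      have "(\<Union>i<n. F i) \<inter> F n = {}"
        using F(2) by (auto simp: disjoint_family_on_def) (metis disjoint_iff less_irrefl)
      then have "upper (\<Union>i<n. F i) + upper (F n) \<le> upper ((\<Union>i<n. F i) \<union> F n)"
        by (rule upper_superadditive)
      moreover have "(\<Union>i<n. F i) \<union> F n = (\<Union>i<Suc n. F i)"
        by (auto simp: less_Suc_eq)
      ultimately show ?case
        using order_trans[OF add_right_mono[OF Suc]] by simp
    qed (simp add: upper_empty)
    moreover have "upper (\<Union>i<n. F i) \<le> upper (\<Union>n. F n)" for n
      by (rule upper_mono) auto
    ultimately show "(\<Sum>n. upper (F n)) \<le> upper (\<Union>n. F n)"
      by (intro suminf_le_const) (auto intro: order_trans)
  next
    have "ennreal (\<nu> B) \<le> (\<Sum>n. upper (F n))" if B: "B \<in> sets borel" "B \<subseteq> (\<Union>n. F n)" for B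
    proof -
      have "(\<lambda>n. \<nu> (B \<inter> F n)) sums \<nu> (\<Union>n. B \<inter> F n)"
        using F B(1) by (intro sums) (auto simp: disjoint_family_on_def)
      also have "(\<Union>n. B \<inter> F n) = B"
        using B(2) by auto
      finally have "(\<lambda>n. ennreal (\<Sum>i<n. \<nu> (B \<inter> F i))) \<longlonglongrightarrow> ennreal (\<nu> B)"
        unfolding sums_def by (rule tendsto_ennrealI)
      moreover have "ennreal (\<Sum>i<n. \<nu> (B \<inter> F i)) \<le> (\<Sum>n. upper (F n))" for n
      proof -
        have "ennreal (\<Sum>i<n. \<nu> (B \<inter> F i)) \<le> ennreal (\<Sum>i<n. max 0 (\<nu> (B \<inter> F i)))"
          by (intro ennreal_leI sum_mono) auto
        also have "\<dots> = (\<Sum>i<n. ennreal (\<nu> (B \<inter> F i)))"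
          by (subst sum_ennreal[symmetric]) (simp_all only: max.cobounded1 ennreal_max_0)
        also have "\<dots> \<le> (\<Sum>i<n. upper (F i))"
          using F(1) B(1) by (intro sum_mono le_upper) auto
        also have "\<dots> \<le> (\<Sum>n. upper (F n))"
          by (intro sum_le_suminf) auto
        finally show ?thesis .
      qed
      ultimately show ?thesis
        by (intro LIMSEQ_le_const2) auto
    qed
    then show "upper (\<Union>n. F n) \<le> (\<Sum>n. upper (F n))"
      unfolding upper_def[of "\<Union>n. F n"] by (intro SUP_least) auto
  qed
qed

lemma sets_jordan_pos [simp]: "sets (jordan_pos \<nu>) = sets borel"
  using sets.sigma_sets_eq[of "borel :: 'a measure"] by (simp add: jordan_pos_def sets_measure_of_conv)

lemma space_jordan_pos [simp]: "space (jordan_pos \<nu>) = UNIV"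
  using sets_eq_imp_space_eq[OF sets_jordan_pos] by simp

lemma emeasure_jordan_pos:
  assumes "A \<in> sets borel"
  shows "emeasure (jordan_pos \<nu>) A = upper A"
proof -
  have "sigma_algebra UNIV (sets borel :: 'a set set)"
    using sets.sigma_algebra_axioms[of "borel :: 'a measure"] by simp
  moreover have "positive (sets borel) upper"
    by (simp add: positive_def upper_empty)
  ultimately show ?thesis
    unfolding jordan_pos_def upper_def[symmetric, abs_def]
    using upper_countably_additive assms by (intro emeasure_measure_of_sigma)
qed

lemma emeasure_jordan_pos_le: "A \<in> sets borel \<Longrightarrow> emeasure (jordan_pos \<nu>) A \<le> ennreal V"
  unfolding emeasure_jordan_pos upper_def
  by (intro SUP_least ennreal_leI) (auto intro: order_trans[OF abs_ge_self bound])

lemma finite_measure_jordan_pos: "finite_measure (jordan_pos \<nu>)"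
  using emeasure_jordan_pos_le[of UNIV] by (intro finite_measureI) (auto simp: top_unique)

lemma measure_jordan_pos_le: "A \<in> sets borel \<Longrightarrow> measure (jordan_pos \<nu>) A \<le> V"
  using emeasure_jordan_pos_le V_nonneg
  by (simp add: finite_measure.emeasure_eq_measure[OF finite_measure_jordan_pos])

lemma ennreal_measure_jordan_pos: "A \<in> sets borel \<Longrightarrow> ennreal (measure (jordan_pos \<nu>) A) = upper A"
  by (simp add: finite_measure.emeasure_eq_measure[OF finite_measure_jordan_pos, symmetric] emeasure_jordan_pos)

lemma le_measure_jordan_pos:
  assumes "A \<in> sets borel" "B \<in> sets borel" "B \<subseteq> A"
  shows "\<nu> B \<le> measure (jordan_pos \<nu>) A"
  using le_upper[OF assms(2,3)] unfolding ennreal_measure_jordan_pos[OF assms(1), symmetric]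
  by (simp add: ennreal_le_iff)

lemma measure_jordan_pos_leI:
  assumes "A \<in> sets borel" "\<And>B. B \<in> sets borel \<Longrightarrow> B \<subseteq> A \<Longrightarrow> \<nu> B \<le> c"
  shows "measure (jordan_pos \<nu>) A \<le> c"
proof -
  have "0 \<le> c"
    using assms(2)[of "{}"] by (simp add: empty)
  moreover have "ennreal (measure (jordan_pos \<nu>) A) \<le> ennreal c"
    unfolding ennreal_measure_jordan_pos[OF assms(1)] upper_def
    by (intro SUP_least ennreal_leI) (auto intro: assms(2))
  ultimately show ?thesis by simp
qed

end

text \<open>A competitor \<open>B\<close> for the positive part corresponds to the competitor \<open>A - B\<close> for the negative part.\<close>

lemma (in bounded_signed_measure) jordan_pos_le:
  assumes "A \<in> sets borel"
  shows "measure (jordan_pos \<nu>) A \<le> \<nu> A + measure (jordan_pos (\<lambda>A. - \<nu> A)) A"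
proof -
  interpret neg: bounded_signed_measure "\<lambda>A. - \<nu> A" V
    by (rule uminus)
  show ?thesis
  proof (rule measure_jordan_pos_leI[OF assms])
    fix B assume B: "B \<in> sets borel" "B \<subseteq> A"
    have "\<nu> (B \<union> (A - B)) = \<nu> B + \<nu> (A - B)"
      using B assms by (intro Un) auto
    moreover have "B \<union> (A - B) = A"
      using B by auto
    moreover have "- \<nu> (A - B) \<le> measure (jordan_pos (\<lambda>A. - \<nu> A)) A"
      using B assms by (intro neg.le_measure_jordan_pos) auto
    ultimately show "\<nu> B \<le> \<nu> A + measure (jordan_pos (\<lambda>A. - \<nu> A)) A"
      by simp
  qed
qed

lemma (in bounded_signed_measure) jordan_decomposition:
  assumes "A \<in> sets borel"
  shows "\<nu> A = measure (jordan_pos \<nu>) A - measure (jordan_pos (\<lambda>A. - \<nu> A)) A"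
  using jordan_pos_le[OF assms] bounded_signed_measure.jordan_pos_le[OF uminus assms] by simp

text \<open>A simple function \<open>\<pi>\<close> from the space to itself serves as a sampling map: its fibres are the cells
  of a finite Borel partition, and \<open>p\<close> is the sample point of the cell \<open>\<pi> -` {p}\<close>. The sum
  is the integral of \<open>f \<circ> \<pi>\<close>.\<close>

lemma integral_sampling_error:
  fixes f :: "'a::topological_space \<Rightarrow> complex"
  assumes "finite_measure \<rho>" "sets \<rho> = sets borel"
    and f: "f \<in> borel_measurable borel" and \<pi>: "simple_function borel \<pi>"
    and err: "\<And>y. cmod (f (\<pi> y) - f y) \<le> \<epsilon>"
  shows "cmod ((\<integral>x. f x \<partial>\<rho>) - (\<Sum>p\<in>range \<pi>. f p * of_real (measure \<rho> (\<pi> -` {p})))) \<le> \<epsilon> * measure \<rho> UNIV"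
proof -
  interpret finite_measure \<rho> by fact
  have sp: "space \<rho> = UNIV"
    using sets_eq_imp_space_eq[OF assms(2)] by simp
  have fib: "\<pi> -` {p} \<in> sets \<rho>" for p
    using simple_function_borel_vimage[OF \<pi>] assms(2) by auto
  have fin: "finite (range \<pi>)"
    by (rule simple_function_borel_finite_range[OF \<pi>])
  have f_pi: "(\<Sum>p\<in>range \<pi>. indicator (\<pi> -` {p}) y *\<^sub>R f p) = f (\<pi> y)" for y
    using fin by (simp add: indicator_def of_bool_def if_distribR if_distrib[of "\<lambda>c. c *\<^sub>R _"] sum.delta cong: if_cong)
  have "has_bochner_integral \<rho> (\<lambda>y. \<Sum>p\<in>range \<pi>. indicator (\<pi> -` {p}) y *\<^sub>R f p)
      (\<Sum>p\<in>range \<pi>. measure \<rho> (\<pi> -` {p}) *\<^sub>R f p)"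
    using fib by (intro has_bochner_integral_sum has_bochner_integral_indicator) (auto simp: emeasure_eq_measure)
  then have int_fpi: "integrable \<rho> (\<lambda>y. f (\<pi> y))"
    and integral_fpi: "(\<integral>y. f (\<pi> y) \<partial>\<rho>) = (\<Sum>p\<in>range \<pi>. f p * of_real (measure \<rho> (\<pi> -` {p})))"
    unfolding f_pi has_bochner_integral_iff by (simp_all add: scaleR_conv_of_real mult.commute)
  have meas: "f \<in> borel_measurable \<rho>"
    using f measurable_cong_sets[OF assms(2) refl, of borel] by auto
  define C where "C = Max ((\<lambda>p. cmod (f p)) ` range \<pi>) + \<epsilon>"
  have "cmod (f y) \<le> C" for y
  proof -
    have "cmod (f y) \<le> cmod (f (\<pi> y)) + cmod (f (\<pi> y) - f y)"
      using norm_triangle_ineq2[of "f y" "f (\<pi> y)"] by (simp add: norm_minus_commute)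
    also have "cmod (f (\<pi> y)) \<le> Max ((\<lambda>p. cmod (f p)) ` range \<pi>)"
      using fin by (intro Max_ge) auto
    finally show ?thesis
      using err[of y] by (simp add: C_def)
  qed
  then have int_f: "integrable \<rho> f"
    using meas by (intro integrable_const_bound[of _ C]) auto
  have "(\<integral>x. f x \<partial>\<rho>) - (\<Sum>p\<in>range \<pi>. f p * of_real (measure \<rho> (\<pi> -` {p}))) = (\<integral>y. f y - f (\<pi> y) \<partial>\<rho>)"
    using int_f int_fpi by (simp add: Bochner_Integration.integral_diff integral_fpi)
  also have "cmod \<dots> \<le> (\<integral>y. cmod (f y - f (\<pi> y)) \<partial>\<rho>)"
    by (rule integral_norm_bound)
  also have "\<dots> \<le> (\<integral>y. \<epsilon> \<partial>\<rho>)"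
    using int_f int_fpi err by (intro integral_mono integrable_norm Bochner_Integration.integrable_diff) (auto simp: norm_minus_commute)
  also have "\<dots> = \<epsilon> * measure \<rho> UNIV"
    by (simp add: sp)
  finally show ?thesis .
qed

lemma (in bounded_signed_measure) signed_integral_sampling_error:
  assumes f: "f \<in> borel_measurable borel" and \<pi>: "simple_function borel \<pi>"
    and err: "\<And>y. cmod (f (\<pi> y) - f y) \<le> \<epsilon>"
  shows "cmod (signed_integral \<nu> f - (\<Sum>p\<in>range \<pi>. f p * of_real (\<nu> (\<pi> -` {p})))) \<le> 2 * V * \<epsilon>"
proof -
  interpret neg: bounded_signed_measure "\<lambda>A. - \<nu> A" V
    by (rule uminus)
  let ?P = "jordan_pos \<nu>" and ?N = "jordan_pos (\<lambda>A. - \<nu> A)"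
  let ?S = "\<lambda>\<rho>. \<Sum>p\<in>range \<pi>. f p * of_real (measure \<rho> (\<pi> -` {p}))"
  have "0 \<le> \<epsilon>"
    using err[of undefined] norm_ge_zero order_trans by blast
  have "(\<Sum>p\<in>range \<pi>. f p * of_real (\<nu> (\<pi> -` {p}))) = ?S ?P - ?S ?N"
    by (simp add: jordan_decomposition[OF simple_function_borel_vimage[OF \<pi>]] sum_subtractf algebra_simps)
  then have "signed_integral \<nu> f - (\<Sum>p\<in>range \<pi>. f p * of_real (\<nu> (\<pi> -` {p}))) =
      ((\<integral>x. f x \<partial>?P) - ?S ?P) - ((\<integral>x. f x \<partial>?N) - ?S ?N)"
    by (simp add: signed_integral_def)
  then have "cmod (signed_integral \<nu> f - (\<Sum>p\<in>range \<pi>. f p * of_real (\<nu> (\<pi> -` {p})))) =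
      cmod (((\<integral>x. f x \<partial>?P) - ?S ?P) - ((\<integral>x. f x \<partial>?N) - ?S ?N))"
    by (rule arg_cong)
  also have "\<dots> \<le> cmod ((\<integral>x. f x \<partial>?P) - ?S ?P) + cmod ((\<integral>x. f x \<partial>?N) - ?S ?N)"
    by (rule norm_triangle_ineq4)
  also have "\<dots> \<le> \<epsilon> * measure ?P UNIV + \<epsilon> * measure ?N UNIV"
    using integral_sampling_error[OF finite_measure_jordan_pos sets_jordan_pos f \<pi> err]
      integral_sampling_error[OF neg.finite_measure_jordan_pos neg.sets_jordan_pos f \<pi> err]
    by (rule add_mono)
  also have "\<dots> \<le> \<epsilon> * V + \<epsilon> * V"
    using \<open>0 \<le> \<epsilon>\<close> by (intro add_mono mult_left_mono measure_jordan_pos_le neg.measure_jordan_pos_le) auto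
  finally show ?thesis by (simp add: algebra_simps)
qed

lemma bounded_signed_measure_Re_Im:
  assumes "complex_borel_measure \<mu>" "variation \<mu> UNIV \<le> ennreal V" "0 \<le> V"
  shows "bounded_signed_measure (\<lambda>A. Re (\<mu> A)) V" "bounded_signed_measure (\<lambda>A. Im (\<mu> A)) V"
proof -
  have sums: "(\<lambda>n. \<mu> (A n)) sums \<mu> (\<Union>n. A n)" if "range A \<subseteq> sets borel" "disjoint_family A" for A :: "nat \<Rightarrow> _"
    using assms(1) that by (simp add: complex_borel_measure_def)
  have "cmod (\<mu> B) \<le> V" if "B \<in> sets borel" for B
    using order_trans[OF cmod_le_variation[OF assms(1) that] assms(2)] assms(3) by simp
  then have "\<bar>Re (\<mu> B)\<bar> \<le> V" "\<bar>Im (\<mu> B)\<bar> \<le> V" if "B \<in> sets borel" for B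
    using that abs_Re_le_cmod abs_Im_le_cmod order_trans by blast+
  then show "bounded_signed_measure (\<lambda>A. Re (\<mu> A)) V" "bounded_signed_measure (\<lambda>A. Im (\<mu> A)) V"
    using sums by (auto intro!: bounded_signed_measure.intro sums_Re sums_Im)
qed

text \<open>The real and the imaginary part have two Jordan parts each, and each of these four measures has mass at most the variation.\<close>

lemma cmeasure_integral_sampling_error:
  assumes \<mu>: "complex_borel_measure \<mu>" "variation \<mu> UNIV \<le> ennreal V" "0 \<le> V"
    and f: "f \<in> borel_measurable borel" and \<pi>: "simple_function borel \<pi>"
    and err: "\<And>y. cmod (f (\<pi> y) - f y) \<le> \<epsilon>"
  shows "cmod (cmeasure_integral \<mu> f - (\<Sum>p\<in>range \<pi>. f p * \<mu> (\<pi> -` {p}))) \<le> 4 * V * \<epsilon>"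
proof -
  let ?S = "\<lambda>\<nu>. \<Sum>p\<in>range \<pi>. f p * of_real (\<nu> (\<pi> -` {p}))"
  let ?Re = "\<lambda>A. Re (\<mu> A)" and ?Im = "\<lambda>A. Im (\<mu> A)"
  have "(\<Sum>p\<in>range \<pi>. f p * \<mu> (\<pi> -` {p})) = (\<Sum>p\<in>range \<pi>. f p * of_real (?Re (\<pi> -` {p})) + \<i> * (f p * of_real (?Im (\<pi> -` {p}))))"
    by (intro sum.cong refl) (subst complex_eq[of "\<mu> _"], simp add: algebra_simps)
  also have "\<dots> = ?S ?Re + \<i> * ?S ?Im"
    by (simp add: sum.distrib sum_distrib_left)
  finally have "cmeasure_integral \<mu> f - (\<Sum>p\<in>range \<pi>. f p * \<mu> (\<pi> -` {p}))
     = (signed_integral ?Re f - ?S ?Re) + \<i> * (signed_integral ?Im f - ?S ?Im)"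
    by (simp add: cmeasure_integral_def algebra_simps)
  then have "cmod (cmeasure_integral \<mu> f - (\<Sum>p\<in>range \<pi>. f p * \<mu> (\<pi> -` {p})))
     = cmod ((signed_integral ?Re f - ?S ?Re) + \<i> * (signed_integral ?Im f - ?S ?Im))"
    by (rule arg_cong)
  also have "\<dots> \<le> cmod (signed_integral ?Re f - ?S ?Re) + cmod (\<i> * (signed_integral ?Im f - ?S ?Im))"
    by (rule norm_triangle_ineq)
  also have "\<dots> \<le> 2 * V * \<epsilon> + 2 * V * \<epsilon>"
    unfolding norm_mult norm_ii mult_1
    using bounded_signed_measure.signed_integral_sampling_error[OF bounded_signed_measure_Re_Im(1)[OF \<mu>] f \<pi> err]
      bounded_signed_measure.signed_integral_sampling_error[OF bounded_signed_measure_Re_Im(2)[OF \<mu>] f \<pi> err]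
    by (rule add_mono)
  finally show ?thesis by simp
qed

section \<open>Measures yield feasible points of the relaxations\<close>

lemma simple_function_floor:
  fixes g :: "'a \<Rightarrow> real"
  assumes [measurable]: "g \<in> borel_measurable M" and "\<And>x. \<bar>g x\<bar> \<le> C"
  shows "simple_function M (\<lambda>x. \<lfloor>g x\<rfloor>)"
proof -
  have "(\<lambda>x. \<lfloor>g x\<rfloor>) ` space M \<subseteq> {\<lfloor>- C\<rfloor>..\<lfloor>C\<rfloor>}"
    using assms(2) by (auto intro!: floor_mono simp: abs_le_iff minus_le_iff)
  then have "finite ((\<lambda>x. \<lfloor>g x\<rfloor>) ` space M)"
    by (rule finite_subset) simp
  then show ?thesis
    by (simp add: simple_function_eq_measurable)
qed

text \<open>Classify points by the integer parts of the real and imaginary parts of \<open>f\<close> in units of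
  \<open>\<epsilon> / 2\<close>. There are finitely many classes because \<open>f\<close> is bounded. The classes of several functions
  are intersected by induction, and in the end one point of each class is chosen.\<close>

lemma finite_sampling_map:
  fixes F :: "('a::topological_space \<Rightarrow> complex) set"
  assumes "finite F" "0 < \<epsilon>"
    and meas: "\<And>f. f \<in> F \<Longrightarrow> f \<in> borel_measurable borel"
    and bdd: "\<And>f x. f \<in> F \<Longrightarrow> cmod (f x) \<le> C"
  obtains \<pi> :: "'a \<Rightarrow> 'a"
  where "simple_function borel \<pi>" "\<And>f y. f \<in> F \<Longrightarrow> cmod (f (\<pi> y) - f y) \<le> \<epsilon>"
proof -
  have "\<exists>\<Phi> :: 'a \<Rightarrow> 'a. simple_function borel \<Phi> \<and> (\<forall>f\<in>F. \<forall>x y. \<Phi> x = \<Phi> y \<longrightarrow> cmod (f x - f y) \<le> \<epsilon>)"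
    using assms(1) meas bdd
  proof (induction F rule: finite_induct)
    case empty
    then show ?case by (intro exI[of _ "\<lambda>_. undefined"]) auto
  next
    case (insert f F)
    have "\<exists>\<Phi> :: 'a \<Rightarrow> 'a. simple_function borel \<Phi> \<and> (\<forall>f\<in>F. \<forall>x y. \<Phi> x = \<Phi> y \<longrightarrow> cmod (f x - f y) \<le> \<epsilon>)"
      by (rule insert.IH) (simp_all add: insert.prems)
    then obtain \<Phi> :: "'a \<Rightarrow> 'a" where \<Phi>: "simple_function borel \<Phi>"
      "\<And>f x y. f \<in> F \<Longrightarrow> \<Phi> x = \<Phi> y \<Longrightarrow> cmod (f x - f y) \<le> \<epsilon>"
      by auto
    define q where "q x = (\<lfloor>Re (f x) / (\<epsilon> / 2)\<rfloor>, \<lfloor>Im (f x) / (\<epsilon> / 2)\<rfloor>)" for x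
    have f [measurable]: "f \<in> borel_measurable borel" and f_le: "\<And>x. cmod (f x) \<le> C"
      using insert.prems by auto
    have "\<bar>Re (f x) / (\<epsilon> / 2)\<bar> \<le> C / (\<epsilon> / 2)" "\<bar>Im (f x) / (\<epsilon> / 2)\<bar> \<le> C / (\<epsilon> / 2)" for x
      unfolding abs_divide using \<open>0 < \<epsilon>\<close> f_le[of x] abs_Re_le_cmod[of "f x"] abs_Im_le_cmod[of "f x"]
      by (auto intro!: divide_right_mono)
    then have q: "simple_function borel q"
      unfolding q_def by (intro simple_function_Pair simple_function_floor) auto
    have q_eq: "cmod (f x - f y) \<le> \<epsilon>" if "q x = q y" for x y
    proof -
      have close: "\<bar>a - b\<bar> \<le> \<epsilon> / 2" if "\<lfloor>a / (\<epsilon> / 2)\<rfloor> = \<lfloor>b / (\<epsilon> / 2)\<rfloor>" for a b :: real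
      proof -
        have "\<bar>a / (\<epsilon> / 2) - b / (\<epsilon> / 2)\<bar> \<le> 1"
          using that by linarith
        then have "\<bar>a - b\<bar> / (\<epsilon> / 2) \<le> 1"
          using \<open>0 < \<epsilon>\<close> by (simp add: diff_divide_distrib[symmetric] abs_divide del: divide_divide_eq_right)
        then show ?thesis
          using \<open>0 < \<epsilon>\<close> by (subst (asm) pos_divide_le_eq) auto
      qed
      have "cmod (f x - f y) \<le> \<bar>Re (f x) - Re (f y)\<bar> + \<bar>Im (f x) - Im (f y)\<bar>"
        using cmod_le[of "f x - f y"] by simp
      also have "\<dots> \<le> \<epsilon> / 2 + \<epsilon> / 2"
        using that by (intro add_mono close) (auto simp: q_def)
      finally show ?thesis by simp
    qed
    define pick where "pick p = (SOME x. (\<Phi> x, q x) = p)" for p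
    have pick: "(\<Phi> (pick (\<Phi> y, q y)), q (pick (\<Phi> y, q y))) = (\<Phi> y, q y)" for y
      unfolding pick_def by (rule someI[of _ y]) simp
    have "simple_function borel (pick \<circ> (\<lambda>x. (\<Phi> x, q x)))"
      using \<Phi>(1) q by (intro simple_function_compose simple_function_Pair)
    moreover have "cmod (g x - g y) \<le> \<epsilon>"
      if "g \<in> insert f F" "(pick \<circ> (\<lambda>x. (\<Phi> x, q x))) x = (pick \<circ> (\<lambda>x. (\<Phi> x, q x))) y" for g x y
    proof -
      have eq: "pick (\<Phi> x, q x) = pick (\<Phi> y, q y)"
        using that(2) by simp
      have "(\<Phi> x, q x) = (\<Phi> (pick (\<Phi> x, q x)), q (pick (\<Phi> x, q x)))"
        by (rule pick[symmetric])
      also have "\<dots> = (\<Phi> y, q y)"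
        unfolding eq by (rule pick)
      finally show ?thesis
        using that(1) \<Phi>(2) q_eq by auto
    qed
    ultimately show ?case by blast
  qed
  then obtain \<Phi> :: "'a \<Rightarrow> 'a" where \<Phi>: "simple_function borel \<Phi>"
      "\<And>f x y. f \<in> F \<Longrightarrow> \<Phi> x = \<Phi> y \<Longrightarrow> cmod (f x - f y) \<le> \<epsilon>"
    by blast
  define pick where "pick p = (SOME x. \<Phi> x = p)" for p
  have pick: "\<Phi> (pick (\<Phi> y)) = \<Phi> y" for y
    unfolding pick_def by (rule someI[of _ y]) simp
  show ?thesis
  proof (rule that)
    show "simple_function borel (pick \<circ> \<Phi>)"
      using \<Phi>(1) by (rule simple_function_compose)
    show "cmod (f ((pick \<circ> \<Phi>) y) - f y) \<le> \<epsilon>" if "f \<in> F" for f y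
      using \<Phi>(2)[OF that pick[of y]] by simp
  qed
qed

text \<open>It suffices to look at the bordered form, because it restricts to the form of the block when the last entry is zero.\<close>

lemma psd_on_of_bordered:
  assumes "finite I" "hermitian_on I R" "\<And>v. 0 \<le> Re (quad_form (insert None (Some ` I)) (bordered R w \<tau>) v)"
  shows "psd_on I R" "psd_on (insert None (Some ` I)) (bordered R w \<tau>)"
proof -
  have "0 \<le> Re (quad_form I R v)" for v
  proof -
    have "(case_option 0 v \<circ> Some) = v" by auto
    then show ?thesis
      using assms(3)[of "case_option 0 v"] unfolding Re_quad_form_bordered[OF assms(1)] by simp
  qed
  then show "psd_on I R"
    using assms(2) by (auto simp: psd_on_def)
  show "psd_on (insert None (Some ` I)) (bordered R w \<tau>)"
    unfolding psd_on_def using hermitian_on_bordered[OF assms(2)] assms(3) by blast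
qed

lemma Re_triple_ge:
  fixes b c s :: complex
  shows "0 \<le> cmod c * (cmod s)\<^sup>2 + 2 * Re (b * (c * s)) + cmod c * (cmod b)\<^sup>2"
proof -
  have "- (cmod b * (cmod c * cmod s)) \<le> Re (b * (c * s))"
    using abs_Re_le_cmod[of "b * (c * s)"] by (simp add: norm_mult abs_le_iff)
  moreover have "0 \<le> cmod c * (cmod s - cmod b)\<^sup>2"
    by simp
  ultimately show ?thesis
    by (simp add: power2_diff algebra_simps)
qed

text \<open>With \<open>b\<close> the last entry of the vector, the form is a sum of nonnegative terms. Each sample \<open>p\<close>
  contributes \<open>|c\<^sub>p| (|s\<^sub>p|\<^sup>2 + |b|\<^sup>2) + 2 Re (b c\<^sub>p s\<^sub>p)\<close>, and each index contributes a
  similar expression from the perturbation \<open>d\<close>: the \<open>\<eta>\<close> in \<open>\<tau>\<close> is shared equally among the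
  indices, which is why \<open>d\<close> must be at most \<open>\<eta> / card I\<close>.\<close>

lemma psd_on_sample_sums:
  fixes P :: "'p set" and c :: "'p \<Rightarrow> complex" and e :: "'i \<Rightarrow> 'p \<Rightarrow> complex" and d :: "'i \<Rightarrow> complex"
  assumes "finite I" "I \<noteq> {}" "0 \<le> \<eta>"
    and d: "\<And>i. i \<in> I \<Longrightarrow> cmod (d i) \<le> \<eta> / card I"
  defines "R \<equiv> \<lambda>i j. (\<Sum>p\<in>P. of_real (cmod (c p)) * (e i p * cnj (e j p))) + (if i = j then of_real \<eta> else 0)"
    and "w \<equiv> \<lambda>i. (\<Sum>p\<in>P. c p * e i p) + d i"
    and "\<tau> \<equiv> (\<Sum>p\<in>P. cmod (c p)) + \<eta>"
  shows "psd_on I R" "psd_on (insert None (Some ` I)) (bordered R w \<tau>)"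
proof -
  have herm: "hermitian_on I R"
    unfolding hermitian_on_def R_def by (auto simp: mult_ac)
  have "0 \<le> Re (quad_form (insert None (Some ` I)) (bordered R w \<tau>) v)" for v
  proof -
    define u where "u = v \<circ> Some"
    define b where "b = v None"
    define s where "s p = (\<Sum>i\<in>I. cnj (u i) * e i p)" for p
    define n where "n = real (card I)"
    have n: "n \<ge> 1"
      using assms(1,2) by (simp add: n_def card_gt_0_iff Suc_le_eq)
    have "quad_form I R u = (\<Sum>i\<in>I. \<Sum>j\<in>I. \<Sum>p\<in>P. of_real (cmod (c p)) * ((cnj (u i) * e i p) * cnj (cnj (u j) * e j p)))
       + (\<Sum>i\<in>I. \<Sum>j\<in>I. if i = j then of_real \<eta> * (cnj (u i) * u j) else 0)"
      unfolding sum.distrib[symmetric]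
      by (intro sum.cong refl) (simp add: R_def sum_distrib_left sum_distrib_right algebra_simps)
    also have "(\<Sum>i\<in>I. \<Sum>j\<in>I. \<Sum>p\<in>P. of_real (cmod (c p)) * ((cnj (u i) * e i p) * cnj (cnj (u j) * e j p)))
      = (\<Sum>p\<in>P. \<Sum>i\<in>I. \<Sum>j\<in>I. of_real (cmod (c p)) * ((cnj (u i) * e i p) * cnj (cnj (u j) * e j p)))"
      by (subst sum.swap, subst sum.swap[of _ I P], subst sum.swap) (intro sum.cong refl sum.swap)
    also have "\<dots> = (\<Sum>p\<in>P. of_real (cmod (c p) * (cmod (s p))\<^sup>2))"
    proof (intro sum.cong refl)
      fix p
      have "of_real ((cmod (s p))\<^sup>2) = (\<Sum>i\<in>I. \<Sum>j\<in>I. (cnj (u i) * e i p) * cnj (cnj (u j) * e j p))"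
        unfolding complex_norm_square s_def cnj_sum sum_product ..
      then show "(\<Sum>i\<in>I. \<Sum>j\<in>I. of_real (cmod (c p)) * ((cnj (u i) * e i p) * cnj (cnj (u j) * e j p)))
          = complex_of_real (cmod (c p) * (cmod (s p))\<^sup>2)"
        by (simp only: of_real_mult sum_distrib_left)
    qed
    also have "(\<Sum>i\<in>I. \<Sum>j\<in>I. if i = j then of_real \<eta> * (cnj (u i) * u j) else 0) = (\<Sum>i\<in>I. of_real (\<eta> * (cmod (u i))\<^sup>2))"
      unfolding of_real_mult complex_norm_square using assms(1) by (intro sum.cong refl) (simp add: mult_ac)
    finally have quad: "Re (quad_form I R u) = (\<Sum>p\<in>P. cmod (c p) * (cmod (s p))\<^sup>2) + (\<Sum>i\<in>I. \<eta> * (cmod (u i))\<^sup>2)"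
      by simp
    have "(\<Sum>i\<in>I. cnj (u i) * w i) = (\<Sum>i\<in>I. \<Sum>p\<in>P. c p * (cnj (u i) * e i p)) + (\<Sum>i\<in>I. cnj (u i) * d i)"
      unfolding sum.distrib[symmetric]
      by (intro sum.cong refl) (simp add: w_def sum_distrib_left algebra_simps)
    also have "(\<Sum>i\<in>I. \<Sum>p\<in>P. c p * (cnj (u i) * e i p)) = (\<Sum>p\<in>P. c p * s p)"
      unfolding s_def sum_distrib_left by (rule sum.swap)
    finally have "b * (\<Sum>i\<in>I. cnj (u i) * w i) = (\<Sum>p\<in>P. b * (c p * s p)) + (\<Sum>i\<in>I. b * (cnj (u i) * d i))"
      by (simp only: distrib_left sum_distrib_left)
    then have lin: "Re (b * (\<Sum>i\<in>I. cnj (u i) * w i)) = (\<Sum>p\<in>P. Re (b * (c p * s p))) + (\<Sum>i\<in>I. Re (b * (cnj (u i) * d i)))"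
      by (simp only: plus_complex.sel Re_sum)
    have "\<eta> * (cmod b)\<^sup>2 = (\<Sum>i\<in>I. \<eta> / n * (cmod b)\<^sup>2)"
      using n by (simp add: n_def)
    then have \<tau>: "\<tau> * (cmod b)\<^sup>2 = (\<Sum>p\<in>P. cmod (c p) * (cmod b)\<^sup>2) + (\<Sum>i\<in>I. \<eta> / n * (cmod b)\<^sup>2)"
      by (simp only: \<tau>_def distrib_right sum_distrib_right)
    have pos: "0 \<le> \<eta> * (cmod (u i))\<^sup>2 + 2 * Re (b * (cnj (u i) * d i)) + \<eta> / n * (cmod b)\<^sup>2" if "i \<in> I" for i
    proof -
      have "- (cmod b * (cmod (u i) * cmod (d i))) \<le> Re (b * (cnj (u i) * d i))"
        using abs_Re_le_cmod[of "b * (cnj (u i) * d i)"] by (simp add: norm_mult abs_le_iff)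
      moreover have "cmod b * (cmod (u i) * cmod (d i)) \<le> cmod b * (cmod (u i) * (\<eta> / n))"
        using d[OF that] by (intro mult_left_mono) (auto simp: n_def)
      moreover have "\<eta> / n * (cmod (u i))\<^sup>2 \<le> \<eta> * (cmod (u i))\<^sup>2"
        using n \<open>0 \<le> \<eta>\<close> by (intro mult_right_mono) (auto simp: divide_le_eq mult_le_cancel_left1)
      moreover have "0 \<le> \<eta> / n * (cmod (u i) - cmod b)\<^sup>2"
        using n \<open>0 \<le> \<eta>\<close> by simp
      then have "2 * (cmod b * (cmod (u i) * (\<eta> / n))) \<le> \<eta> / n * (cmod (u i))\<^sup>2 + \<eta> / n * (cmod b)\<^sup>2"
        by (simp add: power2_diff algebra_simps)
      ultimately show ?thesis by linarith
    qed
    have "Re (quad_form (insert None (Some ` I)) (bordered R w \<tau>) v)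
        = Re (quad_form I R u) + 2 * Re (b * (\<Sum>i\<in>I. cnj (u i) * w i)) + \<tau> * (cmod b)\<^sup>2"
      unfolding Re_quad_form_bordered[OF assms(1)] by (simp only: u_def b_def comp_apply)
    also have "\<dots> = (\<Sum>p\<in>P. cmod (c p) * (cmod (s p))\<^sup>2 + 2 * Re (b * (c p * s p)) + cmod (c p) * (cmod b)\<^sup>2)
       + (\<Sum>i\<in>I. \<eta> * (cmod (u i))\<^sup>2 + 2 * Re (b * (cnj (u i) * d i)) + \<eta> / n * (cmod b)\<^sup>2)"
      unfolding quad lin \<tau> by (simp only: sum.distrib sum_distrib_left distrib_left)
    also have "\<dots> \<ge> 0"
      by (rule add_nonneg_nonneg[OF sum_nonneg[OF Re_triple_ge] sum_nonneg[OF pos]])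
    finally show ?thesis .
  qed
  from psd_on_of_bordered[OF assms(1) herm this]
  show "psd_on I R" "psd_on (insert None (Some ` I)) (bordered R w \<tau>)" by auto
qed

text \<open>The atoms \<open>\<mu> (\<pi> -` {p})\<close> at the sample points give the matrix and the corner, whereas the border is
  the exact vector of Fourier coefficients of \<open>\<mu>\<close>. Its deviation \<open>d\<close> from the coefficients of the
  atoms is the sampling error, small enough to be absorbed by \<open>\<eta>\<close>.\<close>

lemma Q0_relaxed_value_le_variation:
  fixes \<mu> :: "'d::finite torus set \<Rightarrow> complex"
  assumes \<mu>: "bounded_radon_measure \<mu>" and z: "\<And>k. k \<in> freqs fc \<Longrightarrow> fourier_coeff \<mu> k = z k"
  shows "Q0_relaxed_value fc z l \<le> enn2ereal (variation \<mu> UNIV)"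
proof -
  define V where "V = enn2real (variation \<mu> UNIV)"
  have cb: "complex_borel_measure \<mu>" and var: "variation \<mu> UNIV = ennreal V" and "0 \<le> V"
    using \<mu> by (auto simp: bounded_radon_measure_def V_def less_top)
  have "Q0_relaxed_value fc z l \<le> ereal V + ereal \<eta>" if "0 < \<eta>" for \<eta>
  proof -
    let ?I = "freqs l :: (int ^ 'd) set"
    define n where "n = real (card ?I)"
    have n: "n \<ge> 1"
      by (simp add: n_def card_freqs)
    \<comment> \<open>chosen so that the sampling error \<open>4 V \<epsilon>\<close> is at most \<open>\<eta> / n\<close>; the \<open>1\<close> covers \<open>V = 0\<close>\<close>
    define \<epsilon> where "\<epsilon> = \<eta> / (n * (4 * V + 1))"
    have "0 < \<epsilon>"
      using n \<open>0 < \<eta>\<close> \<open>0 \<le> V\<close> by (simp add: \<epsilon>_def)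
    have \<epsilon>: "4 * V * \<epsilon> \<le> \<eta> / n"
    proof -
      have "4 * V * \<epsilon> \<le> (4 * V + 1) * \<epsilon>"
        using \<open>0 < \<epsilon>\<close> by (intro mult_right_mono) auto
      also have "\<dots> = \<eta> / n"
        using \<open>0 \<le> V\<close> by (simp add: \<epsilon>_def)
      finally show ?thesis .
    qed
    obtain \<pi> :: "'d torus \<Rightarrow> 'd torus" where \<pi>: "simple_function borel \<pi>"
      "\<And>f y. f \<in> torus_char ` ?I \<Longrightarrow> cmod (f (\<pi> y) - f y) \<le> \<epsilon>"
    proof (rule finite_sampling_map[of "torus_char ` ?I" \<epsilon> 1])
      show "f \<in> borel_measurable borel" if "f \<in> torus_char ` ?I" for f :: "'d torus \<Rightarrow> complex"
        using that by auto
      show "cmod (f x) \<le> 1" if "f \<in> torus_char ` ?I" for f :: "'d torus \<Rightarrow> complex" and x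
        using that by auto
    qed (use \<open>0 < \<epsilon>\<close> in auto)
    define c where "c p = \<mu> (\<pi> -` {p})" for p
    define d where "d k = fourier_coeff \<mu> k - (\<Sum>p\<in>range \<pi>. c p * torus_char k p)" for k
    have d: "cmod (d k) \<le> \<eta> / card ?I" if "k \<in> ?I" for k
    proof -
      have "cmod (d k) \<le> 4 * V * \<epsilon>"
        using cmeasure_integral_sampling_error[OF cb eq_refl[OF var] \<open>0 \<le> V\<close> borel_measurable_torus_char \<pi>(1), of k \<epsilon>]
          \<pi>(2) that by (auto simp: d_def c_def fourier_coeff_def mult.commute)
      then show ?thesis
        using \<epsilon> by (simp add: n_def)
    qed
    define R where "R i j = (\<Sum>p\<in>range \<pi>. of_real (cmod (c p)) * (torus_char i p * cnj (torus_char j p)))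
        + (if i = j then of_real \<eta> else 0)" for i j
    define w where "w k = (\<Sum>p\<in>range \<pi>. c p * torus_char k p) + d k" for k
    define \<tau> where "\<tau> = (\<Sum>p\<in>range \<pi>. cmod (c p)) + \<eta>"
    have w_eq: "w k = fourier_coeff \<mu> k" for k
      by (simp add: w_def d_def)
    have "?I \<noteq> {}"
      using zero_in_freqs by blast
    then have "psd_on ?I R" "psd_on (insert None (Some ` ?I)) (bordered R w \<tau>)"
      using psd_on_sample_sums[where I = ?I and \<eta> = \<eta> and d = d and P = "range \<pi>" and c = c and e = torus_char] d \<open>0 < \<eta>\<close>
      unfolding R_def[abs_def] w_def[abs_def] \<tau>_def by auto
    moreover have "generalized_toeplitz l R"
    proof -
      have "torus_char (i + k) p * cnj (torus_char (j + k) p) = torus_char i p * cnj (torus_char j p)"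
        for i j k :: "int ^ 'd" and p
        by (simp only: torus_char_diff[symmetric]) simp
      then show ?thesis
        unfolding generalized_toeplitz_def R_def by simp
    qed
    ultimately have "relaxed_feasible fc z l R w \<tau>"
      using z by (auto simp: relaxed_feasible_def w_eq)
    then have "Q0_relaxed_value fc z l \<le> ereal ((Re (R 0 0) + \<tau>) / 2)"
      unfolding Q0_relaxed_value_eq by (intro Inf_lower) blast
    also have "(Re (R 0 0) + \<tau>) / 2 = (\<Sum>p\<in>range \<pi>. cmod (c p)) + \<eta>"
      by (simp add: R_def \<tau>_def)
    also have "(\<Sum>p\<in>range \<pi>. cmod (c p)) \<le> V"
    proof -
      have "ennreal (\<Sum>p\<in>range \<pi>. cmod (c p)) \<le> ennreal V"
        using sum_fibres_le_variation[OF \<pi>(1), of \<mu>] by (simp add: c_def var)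
      then show ?thesis
        using \<open>0 \<le> V\<close> by simp
    qed
    finally show ?thesis by simp
  qed
  then have "Q0_relaxed_value fc z l \<le> ereal V"
    by (rule ereal_le_epsilon2)
  then show ?thesis
    using \<open>0 \<le> V\<close> by (simp add: var enn2ereal_ennreal)
qed

lemma Q0_relaxed_value_le_Q0_value: "Q0_relaxed_value fc (z :: int ^ 'd::finite \<Rightarrow> complex) l \<le> Q0_value fc z"
  unfolding Q0_value_def by (rule Inf_greatest) (auto intro: Q0_relaxed_value_le_variation)

section \<open>Finitely supported complex measures\<close>

definition atomic_measure :: "'g set \<Rightarrow> ('g \<Rightarrow> 'a) \<Rightarrow> ('g \<Rightarrow> complex) \<Rightarrow> 'a set \<Rightarrow> complex" where
  "atomic_measure G x c A = (\<Sum>g\<in>G. c g * indicator A (x g))"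

lemma complex_borel_measure_atomic:
  fixes x :: "'g \<Rightarrow> 'a::topological_space"
  shows "complex_borel_measure (atomic_measure G x c)"
  unfolding complex_borel_measure_def
proof (intro allI impI)
  fix A :: "nat \<Rightarrow> 'a set"
  assume A: "disjoint_family A"
  have "(\<lambda>n. indicator (A n) y :: complex) sums indicator (\<Union>n. A n) y" for y
  proof (cases "y \<in> (\<Union>n. A n)")
    case True
    then obtain n where n: "y \<in> A n" by auto
    then have "indicator (A i) y = (if i = n then 1 else 0 :: complex)" for i
      using A by (auto simp: disjoint_family_on_def indicator_def)
    then show ?thesis
      using True sums_single[of n "\<lambda>_. 1 :: complex"] by (simp add: indicator_def)
  next
    case False
    then show ?thesis by (simp add: indicator_def)
  qed
  then show "(\<lambda>n. atomic_measure G x c (A n)) sums atomic_measure G x c (\<Union>n. A n)"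
    unfolding atomic_measure_def by (intro sums_sum sums_mult)
qed

text \<open>Each atom lies in at most one set of a disjoint family.\<close>

lemma variation_atomic_le:
  assumes "finite G"
  shows "variation (atomic_measure G x c) A \<le> ennreal (\<Sum>g\<in>G. cmod (c g))"
  unfolding variation_def
proof (rule SUP_least)
  fix E :: "nat \<Rightarrow> _ set"
  assume "E \<in> {E. range E \<subseteq> sets borel \<and> disjoint_family E \<and> (\<Union>n. E n) = A}"
  then have E: "disjoint_family E" by auto
  have "(\<Sum>n<N. ennreal (cmod (atomic_measure G x c (E n)))) \<le> ennreal (\<Sum>g\<in>G. cmod (c g))" for N
  proof -
    have "(\<Sum>n<N. cmod (atomic_measure G x c (E n))) \<le> (\<Sum>n<N. \<Sum>g\<in>G. cmod (c g) * indicator (E n) (x g))"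
      unfolding atomic_measure_def
      by (intro sum_mono order_trans[OF norm_sum] eq_refl sum.cong refl) (simp add: norm_mult indicator_def)
    also have "\<dots> = (\<Sum>g\<in>G. cmod (c g) * (\<Sum>n<N. indicator (E n) (x g)))"
      by (subst sum.swap) (simp add: sum_distrib_left)
    also have "\<dots> \<le> (\<Sum>g\<in>G. cmod (c g) * 1)"
    proof (intro sum_mono mult_left_mono)
      fix g
      have "(\<Sum>n<N. indicator (E n) (x g)) = (indicator (\<Union>n<N. E n) (x g) :: real)"
        using E by (intro indicator_UN_disjoint[symmetric] disjoint_family_on_mono[OF _ E]) auto
      then show "(\<Sum>n<N. indicator (E n) (x g)) \<le> (1 :: real)"
        by (simp add: indicator_def)
    qed auto
    finally show ?thesis
      by (simp add: ennreal_leI)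
  qed
  then show "(\<Sum>n. ennreal (cmod (atomic_measure G x c (E n)))) \<le> ennreal (\<Sum>g\<in>G. cmod (c g))"
    by (intro suminf_le_const) auto
qed

text \<open>A Borel partition of \<open>K\<close> becomes one of \<open>A\<close> by adding \<open>A - K\<close>. If \<open>K\<close> is not a Borel set it has no
  Borel partition, and its variation is the empty supremum \<open>0\<close>.\<close>

lemma variation_mono:
  assumes "K \<subseteq> A" "A \<in> sets borel"
  shows "variation \<mu> K \<le> variation \<mu> A"
  unfolding variation_def[of \<mu> K]
proof (rule SUP_least)
  fix E :: "nat \<Rightarrow> 'a set"
  assume "E \<in> {E. range E \<subseteq> sets borel \<and> disjoint_family E \<and> (\<Union>n. E n) = K}"
  then have E: "range E \<subseteq> sets borel" "disjoint_family E" "(\<Union>n. E n) = K" by auto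
  define E' where "E' n = (case n of 0 \<Rightarrow> A - K | Suc n \<Rightarrow> E n)" for n
  have "K \<in> sets borel"
    using E by (metis sets.countable_UN)
  then have "range E' \<subseteq> sets borel"
    using assms(2) E(1) by (auto simp: E'_def split: nat.splits)
  moreover have "disjoint_family E'"
    using E(2,3) by (auto simp: disjoint_family_on_def E'_def split: nat.splits)
  moreover have "(\<Union>n. E' n) = A"
  proof -
    have "(\<Union>n. E' n) = E' 0 \<union> (\<Union>n. E' (Suc n))"
      by (auto, metis not0_implies_Suc)
    then show ?thesis
      using E(3) assms(1) by (auto simp: E'_def)
  qed
  ultimately have "(\<Sum>n. ennreal (cmod (\<mu> (E' n)))) \<le> variation \<mu> A"
    unfolding variation_def by (intro SUP_upper) auto
  moreover have "(\<Sum>n. ennreal (cmod (\<mu> (E n)))) \<le> (\<Sum>n. ennreal (cmod (\<mu> (E' n))))"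
  proof -
    have "(\<Sum>n. ennreal (cmod (\<mu> (E n)))) = (\<Sum>n. ennreal (cmod (\<mu> (E' (Suc n)))))"
      by (simp add: E'_def)
    also have "\<dots> \<le> (\<Sum>n. ennreal (cmod (\<mu> (E' n))))"
      unfolding suminf_offset[OF summableI, of "\<lambda>n. ennreal (cmod (\<mu> (E' n)))" 1, simplified Suc_eq_plus1[symmetric]]
      by (rule add_increasing2) auto
    finally show ?thesis .
  qed
  ultimately show "(\<Sum>n. ennreal (cmod (\<mu> (E n)))) \<le> variation \<mu> A"
    by (rule order_trans[rotated])
qed

text \<open>Inside any Borel set, the finite set of its atoms is a compact Borel set that carries the whole variation.\<close>

lemma bounded_radon_measure_atomic:
  assumes "finite G" and closed_points: "\<And>y :: 'a::topological_space. closed {y}"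
  shows "bounded_radon_measure (atomic_measure G (x :: 'g \<Rightarrow> 'a) c)"
  unfolding bounded_radon_measure_def
proof (intro conjI ballI)
  let ?\<mu> = "atomic_measure G x c"
  show "complex_borel_measure ?\<mu>"
    by (rule complex_borel_measure_atomic)
  show "variation ?\<mu> UNIV < \<infinity>"
    using variation_atomic_le[OF assms(1), of x c UNIV] by (auto intro: le_less_trans)
  fix A :: "'a set"
  assume A: "A \<in> sets borel"
  define K where "K = x ` G \<inter> A"
  have fin: "finite K"
    using assms(1) by (simp add: K_def)
  have K: "K \<in> sets borel"
  proof -
    have "K = (\<Union>y\<in>K. {y})" by auto
    also have "\<dots> \<in> sets borel"
      using fin closed_points by (intro sets.finite_UN) auto
    finally show ?thesis .
  qed
  have "variation ?\<mu> A \<le> variation ?\<mu> K"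
    unfolding variation_def[of ?\<mu> A]
  proof (rule SUP_least)
    fix E :: "nat \<Rightarrow> 'a set"
    assume "E \<in> {E. range E \<subseteq> sets borel \<and> disjoint_family E \<and> (\<Union>n. E n) = A}"
    then have E: "range E \<subseteq> sets borel" "disjoint_family E" "(\<Union>n. E n) = A" by auto
    have "indicator (E n) (x g) = (indicator (E n \<inter> K) (x g) :: complex)" if "g \<in> G" for g n
      using that E(3) by (auto simp: indicator_def K_def)
    then have "?\<mu> (E n) = ?\<mu> (E n \<inter> K)" for n
      unfolding atomic_measure_def by (intro sum.cong) auto
    then have "(\<Sum>n. ennreal (cmod (?\<mu> (E n)))) = (\<Sum>n. ennreal (cmod (?\<mu> (E n \<inter> K))))"
      by simp
    also have "\<dots> \<le> variation ?\<mu> K"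
      unfolding variation_def using E K
      by (intro SUP_upper2[of "\<lambda>n. E n \<inter> K"]) (auto simp: disjoint_family_on_def K_def)
    finally show "(\<Sum>n. ennreal (cmod (?\<mu> (E n)))) \<le> variation ?\<mu> K" .
  qed
  also have "\<dots> \<le> (SUP K \<in> {K. compact K \<and> K \<subseteq> A}. variation ?\<mu> K)"
    using fin by (intro SUP_upper) (auto simp: K_def finite_imp_compact)
  finally have "variation ?\<mu> A \<le> (SUP K \<in> {K. compact K \<and> K \<subseteq> A}. variation ?\<mu> K)" .
  moreover have "(SUP K \<in> {K. compact K \<and> K \<subseteq> A}. variation ?\<mu> K) \<le> variation ?\<mu> A"
    using A by (intro SUP_least variation_mono) auto
  ultimately show "variation ?\<mu> A = (SUP K \<in> {K. compact K \<and> K \<subseteq> A}. variation ?\<mu> K)"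
    by (rule antisym)
qed

text \<open>For every sampling map the Riemann sum of the atomic measure is a sum over its atoms, so both sides are limits of the same sums.\<close>

lemma cmeasure_integral_atomic:
  fixes f :: "'a::topological_space \<Rightarrow> complex"
  assumes "finite G" and f: "f \<in> borel_measurable borel" "\<And>y. cmod (f y) \<le> C"
  shows "cmeasure_integral (atomic_measure G x c) f = (\<Sum>g\<in>G. c g * f (x g))"
proof -
  let ?\<mu> = "atomic_measure G x c"
  define V where "V = (\<Sum>g\<in>G. cmod (c g))"
  have "0 \<le> V"
    by (simp add: V_def sum_nonneg)
  have "cmod (cmeasure_integral ?\<mu> f - (\<Sum>g\<in>G. c g * f (x g))) \<le> 0 + \<epsilon>" if "0 < \<epsilon>" for \<epsilon>
  proof -
    \<comment> \<open>four parts of \<open>V \<delta>\<close> come from the sampling error, a fifth from moving the atoms to their sample points\<close>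
    define \<delta> where "\<delta> = \<epsilon> / (5 * V + 1)"
    have "0 < \<delta>"
      using that \<open>0 \<le> V\<close> by (simp add: \<delta>_def)
    obtain \<pi> :: "'a \<Rightarrow> 'a" where \<pi>: "simple_function borel \<pi>"
      and err: "\<And>h y. h \<in> {f} \<Longrightarrow> cmod (h (\<pi> y) - h y) \<le> \<delta>"
      using finite_sampling_map[of "{f}" \<delta> C] f \<open>0 < \<delta>\<close> by auto
    have "(\<Sum>p\<in>range \<pi>. f p * ?\<mu> (\<pi> -` {p})) = (\<Sum>p\<in>range \<pi>. \<Sum>g\<in>G. if p = \<pi> (x g) then c g * f p else 0)"
      unfolding atomic_measure_def sum_distrib_left by (intro sum.cong refl) (auto simp: indicator_def)
    also have "\<dots> = (\<Sum>g\<in>G. \<Sum>p\<in>range \<pi>. if p = \<pi> (x g) then c g * f p else 0)"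
      by (rule sum.swap)
    also have "\<dots> = (\<Sum>g\<in>G. c g * f (\<pi> (x g)))"
      using simple_function_borel_finite_range[OF \<pi>] by (intro sum.cong refl) (simp add: sum.delta)
    finally have S: "(\<Sum>p\<in>range \<pi>. f p * ?\<mu> (\<pi> -` {p})) = (\<Sum>g\<in>G. c g * f (\<pi> (x g)))" .
    have "cmod (cmeasure_integral ?\<mu> f - (\<Sum>g\<in>G. c g * f (\<pi> (x g)))) \<le> 4 * V * \<delta>"
      unfolding S[symmetric]
      using variation_atomic_le[OF assms(1), of x c UNIV] err \<open>0 \<le> V\<close>
      by (intro cmeasure_integral_sampling_error complex_borel_measure_atomic f \<pi>) (auto simp: V_def)
    moreover have "cmod ((\<Sum>g\<in>G. c g * f (\<pi> (x g))) - (\<Sum>g\<in>G. c g * f (x g))) \<le> V * \<delta>"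
    proof -
      have "(\<Sum>g\<in>G. c g * f (\<pi> (x g))) - (\<Sum>g\<in>G. c g * f (x g)) = (\<Sum>g\<in>G. c g * (f (\<pi> (x g)) - f (x g)))"
        by (simp add: sum_subtractf right_diff_distrib)
      also have "cmod \<dots> \<le> (\<Sum>g\<in>G. cmod (c g) * \<delta>)"
        using err by (intro sum_norm_le) (auto simp: norm_mult intro: mult_left_mono)
      finally show ?thesis
        by (simp add: V_def sum_distrib_right)
    qed
    ultimately have "cmod (cmeasure_integral ?\<mu> f - (\<Sum>g\<in>G. c g * f (x g))) \<le> 4 * V * \<delta> + V * \<delta>"
      by (rule norm_diff_triangle_le)
    also have "\<dots> \<le> (5 * V + 1) * \<delta>"
      using \<open>0 < \<delta>\<close> by (simp add: algebra_simps)
    also have "\<dots> = 0 + \<epsilon>"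
      using \<open>0 \<le> V\<close> by (simp add: \<delta>_def)
    finally show ?thesis .
  qed
  then have "cmod (cmeasure_integral ?\<mu> f - (\<Sum>g\<in>G. c g * f (x g))) \<le> 0"
    by (rule field_le_epsilon)
  then show ?thesis by simp
qed

lemma Q0_value_le_atomic:
  fixes x :: "'g \<Rightarrow> 'd::finite torus"
  assumes "finite G" and "\<And>k. k \<in> freqs fc \<Longrightarrow> (\<Sum>g\<in>G. c g * torus_char k (x g)) = z k"
  shows "Q0_value fc z \<le> ereal (\<Sum>g\<in>G. cmod (c g))"
proof -
  let ?\<mu> = "atomic_measure G x c"
  have "fourier_coeff ?\<mu> k = z k" if "k \<in> freqs fc" for k
    unfolding fourier_coeff_def
    by (subst cmeasure_integral_atomic[of _ _ 1]) (use assms that in auto)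
  moreover have "bounded_radon_measure ?\<mu>"
    using assms(1) closed_torus_point by (rule bounded_radon_measure_atomic)
  ultimately have "Q0_value fc z \<le> enn2ereal (variation ?\<mu> UNIV)"
    unfolding Q0_value_def by (intro Inf_lower) blast
  also have "\<dots> \<le> enn2ereal (ennreal (\<Sum>g\<in>G. cmod (c g)))"
    using variation_atomic_le[OF assms(1), of x c UNIV] by (simp add: less_eq_ennreal.rep_eq)
  also have "\<dots> = ereal (\<Sum>g\<in>G. cmod (c g))"
    by (simp add: enn2ereal_ennreal sum_nonneg)
  finally show ?thesis .
qed

section \<open>Feasible points of the relaxations yield measures\<close>

text \<open>The Fourier coefficient at \<open>k\<close> of the Fejer kernel of the cube \<open>freqs l\<close>, that is, of
  \<open>|\<Sum>\<^sub>j e\<^sub>j|\<^sup>2\<close> divided by the number of terms.\<close>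

definition fejer_weight :: "nat \<Rightarrow> int ^ 'd::finite \<Rightarrow> real" where
  "fejer_weight l k = card {j \<in> freqs l. k + j \<in> freqs l} / card (freqs l :: (int ^ 'd) set)"

text \<open>The fraction of the cube \<open>freqs l\<close> outside \<open>freqs (l - K)\<close>, for \<open>K \<le> l\<close>. It bounds
  \<open>1 - fejer_weight l k\<close> for all \<open>k\<close> in \<open>freqs K\<close>, because the elements of the smaller cube stay in
  \<open>freqs l\<close> when shifted by \<open>k\<close>.\<close>

definition fejer_defect :: "'d::finite itself \<Rightarrow> nat \<Rightarrow> nat \<Rightarrow> real" where
  "fejer_defect _ K l = 1 - ((2 * real (l - K) + 1) / (2 * real l + 1)) ^ CARD('d)"

lemma fejer_weight_0 [simp]: "fejer_weight l 0 = 1"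
  by (simp add: fejer_weight_def card_freqs)

lemma abs_fejer_weight_diff_1_le:
  fixes k :: "int ^ 'd::finite"
  assumes "k \<in> freqs K" "K \<le> l"
  shows "\<bar>fejer_weight l k - 1\<bar> \<le> fejer_defect TYPE('d) K l"
proof -
  let ?J = "{j \<in> freqs l. k + j \<in> freqs l} :: (int ^ 'd) set"
  have "freqs (l - K) \<subseteq> ?J"
    using freqs_mono[of "l - K" l] freqs_add[OF assms(1)] assms(2) by fastforce
  then have "card (freqs (l - K) :: (int ^ 'd) set) \<le> card ?J"
    by (intro card_mono) auto
  then have "real (card (freqs (l - K) :: (int ^ 'd) set)) / card (freqs l :: (int ^ 'd) set) \<le> fejer_weight l k"
    unfolding fejer_weight_def by (intro divide_right_mono) auto
  moreover have "card ?J \<le> card (freqs l :: (int ^ 'd) set)"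
    by (intro card_mono) auto
  then have "fejer_weight l k \<le> 1"
    by (auto simp: fejer_weight_def divide_le_eq_1 card_gt_0_iff)
  moreover have "(2 * real n + 1) ^ CARD('d) = card (freqs n :: (int ^ 'd) set)" for n
    by (simp add: card_freqs add.commute)
  ultimately show ?thesis
    unfolding fejer_defect_def power_divide by simp
qed

lemma fejer_defect_nonneg: "0 \<le> fejer_defect TYPE('d::finite) K l"
proof -
  have "((2 * real (l - K) + 1) / (2 * real l + 1)) ^ CARD('d) \<le> 1"
    by (intro power_le_one) (auto simp: divide_le_eq_1)
  then show ?thesis by (simp add: fejer_defect_def)
qed

lemma tendsto_fejer_defect: "(fejer_defect TYPE('d::finite) K) \<longlonglongrightarrow> 0"
proof -
  have "(\<lambda>n. (2 * real n + 1) / (2 * real (n + K) + 1)) \<longlonglongrightarrow> 1"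
    by real_asymp
  then have "(\<lambda>n. (2 * real (n + K - K) + 1) / (2 * real (n + K) + 1)) \<longlonglongrightarrow> 1"
    by simp
  then have "(\<lambda>l. (2 * real (l - K) + 1) / (2 * real l + 1)) \<longlonglongrightarrow> 1"
    by (rule LIMSEQ_offset)
  then have "(\<lambda>l. 1 - ((2 * real (l - K) + 1) / (2 * real l + 1)) ^ CARD('d)) \<longlonglongrightarrow> 1 - 1 ^ CARD('d)"
    by (intro tendsto_intros)
  then show ?thesis
    by (simp add: fejer_defect_def[abs_def])
qed

lemma toeplitz_shift:
  assumes "generalized_toeplitz l R" "i \<in> freqs l" "j \<in> freqs l" "i - j \<in> freqs l"
  shows "R i j = R (i - j) 0"
proof -
  have "R ((i - j) + j) (0 + j) = R (i - j) 0"
    using assms unfolding generalized_toeplitz_def by (metis add_0 diff_add_cancel zero_in_freqs)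
  then show ?thesis by simp
qed

text \<open>\<open>P\<close> is the form of \<open>R\<close> at the vector of characters, divided by the dimension. It is nonnegative
  because \<open>R\<close> is positive semidefinite. Expanded, its coefficient at \<open>k\<close> is the normalized sum of the
  entries \<open>R\<^sub>k\<^sub>+\<^sub>j\<^sub>,\<^sub>j\<close>, which all equal \<open>R\<^sub>k\<^sub>,\<^sub>0\<close>. The test character
  \<open>e\<^sub>k\<close> and the two of the form together have frequency at most \<open>3 l\<close>, which fixes the degree of
  exactness of the quadrature.\<close>

lemma toeplitz_density:
  fixes R :: "int ^ 'd::finite \<Rightarrow> int ^ 'd \<Rightarrow> complex"
  assumes psd: "psd_on (freqs l) R" and toep: "generalized_toeplitz l R"
    and quadrature: "\<And>q. q \<in> freqs (3 * l) \<Longrightarrow> (\<Sum>g\<in>G. torus_char q (x g)) / of_nat (card G) = (if q = 0 then 1 else 0)"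
  obtains P :: "'d torus \<Rightarrow> real"
  where "\<And>y. 0 \<le> P y"
    "\<And>k. k \<in> freqs l \<Longrightarrow> (\<Sum>g\<in>G. torus_char k (x g) * of_real (P (x g))) / of_nat (card G) = of_real (fejer_weight l k) * R k 0"
proof -
  let ?I = "freqs l :: (int ^ 'd) set"
  define m where "m = card ?I"
  define P where "P y = Re (quad_form ?I R (\<lambda>i. torus_char i y)) / m" for y
  show ?thesis
  proof (rule that)
    show "0 \<le> P y" for y
      using psd_onD[OF psd] by (simp only: P_def) simp
  next
    fix k :: "int ^ 'd" assume k: "k \<in> freqs l"
    have P: "torus_char k y * of_real (P y) = (\<Sum>i\<in>?I. \<Sum>j\<in>?I. R i j * torus_char (k + j - i) y) / of_nat m" for y
    proof -
      have "of_real (P y) = quad_form ?I R (\<lambda>i. torus_char i y) / of_nat m"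
        by (subst psd_on_quad_form_real[OF psd]) (simp add: P_def)
      moreover have "torus_char k y * quad_form ?I R (\<lambda>i. torus_char i y) = (\<Sum>i\<in>?I. \<Sum>j\<in>?I. R i j * torus_char (k + j - i) y)"
        unfolding sum_distrib_left by (intro sum.cong refl) (simp add: torus_char_diff torus_char_add mult_ac)
      ultimately show ?thesis by simp
    qed
    have "(\<Sum>g\<in>G. torus_char k (x g) * of_real (P (x g))) / of_nat (card G)
        = (\<Sum>g\<in>G. \<Sum>i\<in>?I. \<Sum>j\<in>?I. R i j * torus_char (k + j - i) (x g)) / of_nat (card G) / of_nat m"
      unfolding P by (simp add: sum_divide_distrib[symmetric])
    also have "(\<Sum>g\<in>G. \<Sum>i\<in>?I. \<Sum>j\<in>?I. R i j * torus_char (k + j - i) (x g))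
        = (\<Sum>i\<in>?I. \<Sum>j\<in>?I. R i j * (\<Sum>g\<in>G. torus_char (k + j - i) (x g)))"
      unfolding sum_distrib_left
      by (subst sum.swap, intro sum.cong refl, subst sum.swap) (rule refl)
    also have "\<dots> / of_nat (card G) = (\<Sum>i\<in>?I. \<Sum>j\<in>?I. R i j * ((\<Sum>g\<in>G. torus_char (k + j - i) (x g)) / of_nat (card G)))"
      by (simp only: sum_divide_distrib[of _ ?I] times_divide_eq_right)
    also have "\<dots> = (\<Sum>i\<in>?I. \<Sum>j\<in>?I. if i = k + j then R k 0 else 0)"
    proof (intro sum.cong refl)
      fix i j assume ij: "i \<in> ?I" "j \<in> ?I"
      have "l + l + l = 3 * l" by simp
      then have "k + j - i \<in> freqs (3 * l)"
        using freqs_diff[OF freqs_add[OF k ij(2)] ij(1)] by (simp only:)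
      then have "(\<Sum>g\<in>G. torus_char (k + j - i) (x g)) / of_nat (card G) = (if k + j - i = 0 then 1 else 0)"
        by (rule quadrature)
      moreover have "R i j = R k 0" if "i = k + j"
        using toeplitz_shift[OF toep ij] that k by simp
      ultimately show "R i j * ((\<Sum>g\<in>G. torus_char (k + j - i) (x g)) / of_nat (card G)) = (if i = k + j then R k 0 else 0)"
        by auto
    qed
    also have "\<dots> = (\<Sum>j\<in>?I. if k + j \<in> ?I then R k 0 else 0)"
      by (subst sum.swap) (simp add: sum.delta)
    also have "\<dots> = of_nat (card {j \<in> ?I. k + j \<in> ?I}) * R k 0"
      by (simp add: sum.If_cases Collect_conj_eq)
    finally show "(\<Sum>g\<in>G. torus_char k (x g) * of_real (P (x g))) / of_nat (card G) = of_real (fejer_weight l k) * R k 0"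
      by (simp add: fejer_weight_def m_def)
  qed
qed

lemma norm_sum_char_le:
  "cmod (\<Sum>k\<in>I. d k * cnj (torus_char k y)) \<le> (\<Sum>k\<in>I. cmod (d k))"
  by (rule order_trans[OF norm_sum]) (simp add: norm_mult)

text \<open>The number \<open>S\<close> is the sum of the \<open>|a\<^sub>j|\<close> for the solution \<open>a\<close> of the regularized system. The
  density \<open>A P\<close> has norm at most \<open>(\<integral>P + \<integral>|A|\<^sup>2 P) / 2\<close>. Here \<open>\<integral>P = r\<close>, and
  \<open>\<integral>|A|\<^sup>2 P\<close> differs from \<open>a\<^sup>* R a \<le> \<tau>\<close> by at most \<open>\<kappa> r S\<^sup>2\<close>, since \<open>|R\<^sub>i\<^sub>j| \<le> r\<close>. The
  \<open>k\<close>-th coefficient of \<open>A P\<close> misses \<open>z\<^sub>k\<close> by at most \<open>\<delta> |a\<^sub>k| + \<kappa> r S\<close>; the correcting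
  polynomial \<open>H\<close> has these errors as coefficients, which gives the last two terms of the bound.\<close>

lemma Q0_value_le_relaxed:
  fixes z :: "int ^ 'd::finite \<Rightarrow> complex"
  assumes feas: "relaxed_feasible fc z l R w \<tau>" and l: "2 * fc \<le> l" and "0 < \<delta>"
  defines "r \<equiv> Re (R 0 0)" and "m \<equiv> real (card (freqs fc :: (int ^ 'd) set))"
    and "\<kappa> \<equiv> fejer_defect TYPE('d) (2 * fc) l"
  obtains S where "0 \<le> S" "\<delta> * S\<^sup>2 \<le> m * \<tau>"
    "Q0_value fc z \<le> ereal ((r + \<tau>) / 2 + (\<kappa> * r * S\<^sup>2 / 2 + \<delta> * S + m * (\<kappa> * r * S)))"
proof -
  let ?I = "freqs fc :: (int ^ 'd) set"
  have sub: "?I \<subseteq> freqs l"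
    using l by (intro freqs_mono) simp
  have psd_l: "psd_on (freqs l) R" and bord_l: "psd_on (insert None (Some ` freqs l)) (bordered R w \<tau>)"
    and toep: "generalized_toeplitz l R" and w: "\<And>k. k \<in> ?I \<Longrightarrow> w k = z k"
    using feas by (auto simp: relaxed_feasible_def)
  have psd: "psd_on ?I R"
    by (rule psd_on_subset[OF _ sub psd_l]) simp
  have bord: "psd_on (insert None (Some ` ?I)) (bordered R w \<tau>)"
    by (rule psd_on_subset[OF _ _ bord_l]) (use sub in auto)
  have diff_l: "k - j \<in> freqs l" if "k \<in> ?I" "j \<in> ?I" for k j
    using freqs_diff[OF that] freqs_mono[of "fc + fc" l] l by (auto simp: mult_2)
  have diff_2: "k - j \<in> freqs (2 * fc)" if "k \<in> ?I" "j \<in> ?I" for k j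
    using freqs_diff[OF that] by (simp add: mult_2)
  have R_shift: "R (k - j) 0 = R k j" if "k \<in> ?I" "j \<in> ?I" for k j
    by (rule toeplitz_shift[OF toep _ _ diff_l[OF that], symmetric]) (use that sub in auto)
  have R_diag: "Re (R k k) = r" if "k \<in> ?I" for k
    using R_shift[OF that that] by (simp add: r_def)
  have R_le: "cmod (R k j) \<le> r" if "k \<in> ?I" "j \<in> ?I" for k j
    using psd_on_entry_bound[OF _ psd that] by (simp add: R_diag that)
  have "0 \<le> r"
    using R_le[of 0 0] order_trans[OF norm_ge_zero] by auto
  have "0 \<le> \<kappa>"
    unfolding \<kappa>_def by (rule fejer_defect_nonneg)
  obtain a where a: "\<And>k. k \<in> ?I \<Longrightarrow> (\<Sum>j\<in>?I. R k j * a j) + of_real \<delta> * a k = w k"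
    using ridge_system_solvable[OF _ psd \<open>0 < \<delta>\<close>, of w] by auto
  define s where "s = Re (quad_form ?I R a)"
  define S where "S = (\<Sum>j\<in>?I. cmod (a j))"
  have "0 \<le> S"
    by (simp add: S_def sum_nonneg)
  have "0 \<le> s"
    unfolding s_def by (rule psd_onD[OF psd])
  have bound: "s + 2 * \<delta> * (\<Sum>j\<in>?I. (cmod (a j))\<^sup>2) \<le> \<tau>"
    unfolding s_def by (rule ridge_solution_bound[OF _ bord a]) simp_all
  have "0 \<le> \<delta> * (\<Sum>j\<in>?I. (cmod (a j))\<^sup>2)"
    using \<open>0 < \<delta>\<close> by (simp add: sum_nonneg)
  then have s_le: "s \<le> \<tau>" and sq_le: "\<delta> * (\<Sum>j\<in>?I. (cmod (a j))\<^sup>2) \<le> \<tau>"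
    using bound \<open>0 \<le> s\<close> by simp_all
  have S2: "\<delta> * S\<^sup>2 \<le> m * \<tau>"
  proof -
    have "S\<^sup>2 \<le> (\<Sum>j\<in>?I. (cmod (a j))\<^sup>2) * m"
      unfolding S_def m_def by (rule sum_squared_le_sum_of_squares)
    then have "\<delta> * S\<^sup>2 \<le> \<delta> * ((\<Sum>j\<in>?I. (cmod (a j))\<^sup>2) * m)"
      using \<open>0 < \<delta>\<close> by (intro mult_left_mono) auto
    also have "\<dots> \<le> \<tau> * m"
      using mult_right_mono[OF sq_le, of m] by (simp add: m_def mult.assoc)
    finally show ?thesis by (simp add: mult.commute)
  qed
  obtain G :: "('d \<Rightarrow> nat) set" and x :: "('d \<Rightarrow> nat) \<Rightarrow> 'd torus" where G: "finite G" "G \<noteq> {}"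
    and quadrature: "\<And>q. q \<in> freqs (3 * l) \<Longrightarrow> (\<Sum>g\<in>G. torus_char q (x g)) / of_nat (card G) = (if q = 0 then 1 else 0)"
    using torus_quadrature[of "3 * l"] by metis
  obtain P :: "'d torus \<Rightarrow> real" where P: "\<And>y. 0 \<le> P y"
    and P_hat: "\<And>k. k \<in> freqs l \<Longrightarrow> (\<Sum>g\<in>G. torus_char k (x g) * of_real (P (x g))) / of_nat (card G) = of_real (fejer_weight l k) * R k 0"
    using toeplitz_density[OF psd_l toep quadrature] by metis
  \<comment> \<open>the average over the grid, in the role of the integral over the torus\<close>
  define E where "E f = (\<Sum>g\<in>G. f (x g)) / of_nat (card G)" for f :: "'d torus \<Rightarrow> complex"
  have E_sum: "E (\<lambda>y. \<Sum>j\<in>J. f j y) = (\<Sum>j\<in>J. E (f j))" for f :: "int ^ 'd \<Rightarrow> _" and J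
    unfolding E_def by (subst sum.swap) (simp add: sum_divide_distrib)
  have E_mult: "E (\<lambda>y. c * f y) = c * E f" for c f
    unfolding E_def by (simp add: sum_distrib_left)
  have E_add: "E (\<lambda>y. f y + h y) = E f + E h" for f h
    unfolding E_def by (simp add: sum.distrib add_divide_distrib)
  have E_P: "E (\<lambda>y. torus_char (k - j) y * of_real (P y)) = of_real (fejer_weight l (k - j)) * R k j"
    if "k \<in> ?I" "j \<in> ?I" for k j
    using P_hat[OF diff_l[OF that]] R_shift[OF that] by (simp add: E_def)
  have E_char: "E (torus_char (k - j)) = (if k = j then 1 else 0)" if "k \<in> ?I" "j \<in> ?I" for k j
    using quadrature[of "k - j"] diff_l[OF that] freqs_mono[of l "3 * l"] by (auto simp: E_def)
  have weight_err: "cmod (of_real (fejer_weight l (k - j)) * R k j - R k j) \<le> \<kappa> * r" if "k \<in> ?I" "j \<in> ?I" for k j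
  proof -
    have "of_real (fejer_weight l (k - j)) * R k j - R k j = of_real (fejer_weight l (k - j) - 1) * R k j"
      by (simp add: algebra_simps)
    then have "cmod (of_real (fejer_weight l (k - j)) * R k j - R k j) = \<bar>fejer_weight l (k - j) - 1\<bar> * cmod (R k j)"
      by (simp only: norm_mult norm_of_real)
    also have "\<dots> \<le> \<kappa> * r"
      unfolding \<kappa>_def
      by (intro mult_mono abs_fejer_weight_diff_1_le diff_2 that l R_le fejer_defect_nonneg norm_ge_zero)
    finally show ?thesis .
  qed
  define A where "A y = (\<Sum>j\<in>?I. a j * cnj (torus_char j y))" for y
  define b where "b k = E (\<lambda>y. torus_char k y * (A y * of_real (P y)))" for k
  define d where "d k = w k - b k" for k
  define H where "H y = (\<Sum>k\<in>?I. d k * cnj (torus_char k y))" for y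
  have b: "b k = (\<Sum>j\<in>?I. a j * (of_real (fejer_weight l (k - j)) * R k j))" if k: "k \<in> ?I" for k
  proof -
    have "(\<lambda>y. torus_char k y * (A y * of_real (P y))) = (\<lambda>y. \<Sum>j\<in>?I. a j * (torus_char (k - j) y * of_real (P y)))"
      by (simp add: A_def sum_distrib_left sum_distrib_right torus_char_diff mult_ac)
    then have "b k = (\<Sum>j\<in>?I. a j * E (\<lambda>y. torus_char (k - j) y * of_real (P y)))"
      unfolding b_def by (simp only: E_sum E_mult)
    then show ?thesis
      using k by (simp add: E_P)
  qed
  have d_le: "cmod (d k) \<le> \<delta> * cmod (a k) + \<kappa> * r * S" if k: "k \<in> ?I" for k
  proof -
    have "d k = of_real \<delta> * a k - (\<Sum>j\<in>?I. a j * (of_real (fejer_weight l (k - j)) * R k j - R k j))"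
      unfolding d_def b[OF k] a[OF k, symmetric] by (simp add: right_diff_distrib sum_subtractf mult.commute)
    then have "cmod (d k) \<le> cmod (of_real \<delta> * a k) + cmod (\<Sum>j\<in>?I. a j * (of_real (fejer_weight l (k - j)) * R k j - R k j))"
      by (simp only: norm_triangle_ineq4)
    also have "cmod (\<Sum>j\<in>?I. a j * (of_real (fejer_weight l (k - j)) * R k j - R k j)) \<le> (\<Sum>j\<in>?I. cmod (a j) * (\<kappa> * r))"
      by (intro sum_norm_le) (simp only: norm_mult mult_left_mono weight_err k norm_ge_zero)
    also have "\<dots> = \<kappa> * r * S"
      by (simp add: S_def sum_distrib_left mult_ac)
    finally show ?thesis
      using \<open>0 < \<delta>\<close> by (simp add: norm_mult)
  qed
  have E_H: "E (\<lambda>y. torus_char k y * H y) = d k" if k: "k \<in> ?I" for k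
  proof -
    have "(\<lambda>y. torus_char k y * H y) = (\<lambda>y. \<Sum>j\<in>?I. d j * torus_char (k - j) y)"
      by (simp add: H_def sum_distrib_left torus_char_diff mult_ac)
    then have "E (\<lambda>y. torus_char k y * H y) = (\<Sum>j\<in>?I. d j * E (torus_char (k - j)))"
      by (simp only: E_sum E_mult)
    also have "\<dots> = (\<Sum>j\<in>?I. if j = k then d j else 0)"
      using k by (intro sum.cong) (auto simp: E_char)
    finally show ?thesis
      using k by (simp add: sum.delta)
  qed
  define c where "c g = (A (x g) * of_real (P (x g)) + H (x g)) / of_nat (card G)" for g
  have "Q0_value fc z \<le> ereal (\<Sum>g\<in>G. cmod (c g))"
  proof (rule Q0_value_le_atomic[OF G(1)])
    fix k assume k: "k \<in> ?I"
    have "(\<Sum>g\<in>G. c g * torus_char k (x g)) = E (\<lambda>y. torus_char k y * (A y * of_real (P y)) + torus_char k y * H y)"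
      unfolding E_def c_def sum_divide_distrib by (intro sum.cong refl) (simp add: algebra_simps)
    also have "\<dots> = b k + d k"
      unfolding E_add E_H[OF k] b_def ..
    also have "\<dots> = z k"
      using w[OF k] by (simp add: d_def)
    finally show "(\<Sum>g\<in>G. c g * torus_char k (x g)) = z k" .
  qed
  also have "(\<Sum>g\<in>G. cmod (c g)) \<le> (r + \<tau>) / 2 + (\<kappa> * r * S\<^sup>2 / 2 + \<delta> * S + m * (\<kappa> * r * S))"
  proof -
    define N where "N = real (card G)"
    have "0 < N"
      using G by (simp add: N_def card_gt_0_iff)
    have "cmod (c g) \<le> (P (x g) + P (x g) * (cmod (A (x g)))\<^sup>2) / 2 / N + (\<Sum>k\<in>?I. cmod (d k)) / N" for g
    proof -
      have "cmod (A (x g) * of_real (P (x g)) + H (x g)) \<le> cmod (A (x g)) * P (x g) + cmod (H (x g))"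
        using norm_triangle_ineq[of "A (x g) * of_real (P (x g))" "H (x g)"] P[of "x g"] by (simp add: norm_mult)
      moreover have "cmod (H (x g)) \<le> (\<Sum>k\<in>?I. cmod (d k))"
        unfolding H_def by (rule norm_sum_char_le)
      moreover have "cmod (A (x g)) * P (x g) \<le> (P (x g) + P (x g) * (cmod (A (x g)))\<^sup>2) / 2"
      proof -
        have "0 \<le> P (x g) * (cmod (A (x g)) - 1)\<^sup>2"
          using P by simp
        then show ?thesis
          by (simp add: power2_diff algebra_simps)
      qed
      ultimately have "cmod (A (x g) * of_real (P (x g)) + H (x g))
          \<le> (P (x g) + P (x g) * (cmod (A (x g)))\<^sup>2) / 2 + (\<Sum>k\<in>?I. cmod (d k))"
        by linarith
      then have "cmod (A (x g) * of_real (P (x g)) + H (x g)) / N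
          \<le> ((P (x g) + P (x g) * (cmod (A (x g)))\<^sup>2) / 2 + (\<Sum>k\<in>?I. cmod (d k))) / N"
        using \<open>0 < N\<close> by (intro divide_right_mono) auto
      moreover have "cmod (c g) = cmod (A (x g) * of_real (P (x g)) + H (x g)) / N"
        by (simp only: c_def norm_divide N_def norm_of_nat)
      ultimately show ?thesis
        by (simp add: add_divide_distrib)
    qed
    then have "(\<Sum>g\<in>G. cmod (c g)) \<le> (\<Sum>g\<in>G. (P (x g) + P (x g) * (cmod (A (x g)))\<^sup>2) / 2 / N + (\<Sum>k\<in>?I. cmod (d k)) / N)"
      by (rule sum_mono)
    also have "\<dots> = ((\<Sum>g\<in>G. P (x g)) / N + (\<Sum>g\<in>G. P (x g) * (cmod (A (x g)))\<^sup>2) / N) / 2 + (\<Sum>k\<in>?I. cmod (d k))"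
      using \<open>0 < N\<close> by (simp add: sum.distrib sum_divide_distrib[symmetric] N_def add_divide_distrib)
    also have "(\<Sum>g\<in>G. P (x g)) / N = r"
    proof -
      have "complex_of_real ((\<Sum>g\<in>G. P (x g)) / N) = R 0 0"
        using P_hat[of 0] by (simp add: N_def)
      then show ?thesis
        unfolding r_def by (metis Re_complex_of_real)
    qed
    also have "(\<Sum>g\<in>G. P (x g) * (cmod (A (x g)))\<^sup>2) / N \<le> \<tau> + \<kappa> * r * S\<^sup>2"
    proof -
      have "complex_of_real ((\<Sum>g\<in>G. P (x g) * (cmod (A (x g)))\<^sup>2) / N) = E (\<lambda>y. of_real (P y) * (cnj (A y) * A y))"
        by (simp add: E_def N_def complex_norm_square mult_ac del: of_real_power)
      also have "(\<lambda>y. of_real (P y) * (cnj (A y) * A y))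
          = (\<lambda>y. \<Sum>i\<in>?I. \<Sum>j\<in>?I. cnj (a i) * a j * (torus_char (i - j) y * of_real (P y)))"
        by (simp add: A_def sum_product sum_distrib_left torus_char_diff mult_ac)
      also have "E \<dots> = (\<Sum>i\<in>?I. \<Sum>j\<in>?I. cnj (a i) * a j * E (\<lambda>y. torus_char (i - j) y * of_real (P y)))"
        by (simp only: E_sum E_mult)
      also have "\<dots> = (\<Sum>i\<in>?I. \<Sum>j\<in>?I. cnj (a i) * a j * (of_real (fejer_weight l (i - j)) * R i j))"
        by (intro sum.cong refl) (simp add: E_P)
      also have "\<dots> = quad_form ?I R a + (\<Sum>i\<in>?I. \<Sum>j\<in>?I. cnj (a i) * a j * (of_real (fejer_weight l (i - j)) * R i j - R i j))"
        unfolding sum.distrib[symmetric] by (intro sum.cong refl) (simp add: algebra_simps)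
      finally have "(\<Sum>g\<in>G. P (x g) * (cmod (A (x g)))\<^sup>2) / N
          = s + Re (\<Sum>i\<in>?I. \<Sum>j\<in>?I. cnj (a i) * a j * (of_real (fejer_weight l (i - j)) * R i j - R i j))"
        unfolding s_def by (metis Re_complex_of_real plus_complex.sel(1))
      also have "Re (\<Sum>i\<in>?I. \<Sum>j\<in>?I. cnj (a i) * a j * (of_real (fejer_weight l (i - j)) * R i j - R i j))
          \<le> cmod (\<Sum>i\<in>?I. \<Sum>j\<in>?I. cnj (a i) * a j * (of_real (fejer_weight l (i - j)) * R i j - R i j))"
        by (rule complex_Re_le_cmod)
      also have "\<dots> \<le> (\<Sum>i\<in>?I. \<Sum>j\<in>?I. cmod (a i) * cmod (a j) * (\<kappa> * r))"
      proof (intro sum_norm_le)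
        fix i j assume ij: "i \<in> ?I" "j \<in> ?I"
        show "cmod (cnj (a i) * a j * (of_real (fejer_weight l (i - j)) * R i j - R i j)) \<le> cmod (a i) * cmod (a j) * (\<kappa> * r)"
          unfolding norm_mult complex_mod_cnj by (intro mult_left_mono weight_err ij mult_nonneg_nonneg norm_ge_zero)
      qed
      also have "\<dots> = \<kappa> * r * S\<^sup>2"
        unfolding S_def power2_eq_square sum_product by (simp add: sum_distrib_left mult_ac)
      finally show ?thesis
        using s_le by simp
    qed
    also have "(\<Sum>k\<in>?I. cmod (d k)) \<le> \<delta> * S + m * (\<kappa> * r * S)"
    proof -
      have "(\<Sum>k\<in>?I. cmod (d k)) \<le> (\<Sum>k\<in>?I. \<delta> * cmod (a k) + \<kappa> * r * S)"
        by (intro sum_mono d_le)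
      then show ?thesis
        by (simp add: sum.distrib S_def sum_distrib_left m_def)
    qed
    finally show ?thesis by (simp add: add_divide_distrib)
  qed
  finally show ?thesis
    using that[OF \<open>0 \<le> S\<close> S2] by simp
qed

text \<open>Feasible points of value at most \<open>C\<close> have \<open>R\<^sub>0\<^sub>0, \<tau> \<le> 2 C\<close>, hence \<open>S\<close> is at most a constant \<open>B\<close>
  of order \<open>\<delta>\<close> to the power \<open>-1/2\<close>. First \<open>\<delta>\<close> is chosen so that \<open>\<delta> B \<le> \<epsilon> / 2\<close>; then the Fejer
  defect, the only quantity that still depends on \<open>l\<close>, makes the other terms small.\<close>

lemma eventually_Q0_value_le_relaxed:
  fixes z :: "int ^ 'd::finite \<Rightarrow> complex"
  assumes "0 < \<epsilon>" "0 \<le> C"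
  shows "\<forall>\<^sub>F l in sequentially. \<forall>R w \<tau>. relaxed_feasible fc z l R w \<tau> \<longrightarrow> (Re (R 0 0) + \<tau>) / 2 \<le> C
    \<longrightarrow> Q0_value fc z \<le> ereal ((Re (R 0 0) + \<tau>) / 2 + \<epsilon>)"
proof -
  define m where "m = real (card (freqs fc :: (int ^ 'd) set))"
  define \<delta> where "\<delta> = (\<epsilon> / 2)\<^sup>2 / (2 * m * C + 1)"
  define B where "B = sqrt (2 * m * C / \<delta>)"
  have "0 \<le> m" by (simp add: m_def)
  have "0 < 2 * m * C + 1"
    using \<open>0 \<le> m\<close> \<open>0 \<le> C\<close> by (simp add: add_nonneg_pos)
  then have "0 < \<delta>"
    using \<open>0 < \<epsilon>\<close> by (simp add: \<delta>_def)
  have "0 \<le> B"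
    using \<open>0 \<le> m\<close> \<open>0 \<le> C\<close> \<open>0 < \<delta>\<close> by (simp add: B_def)
  have \<delta>B: "\<delta> * B \<le> \<epsilon> / 2"
  proof (rule power2_le_imp_le)
    have "B\<^sup>2 = 2 * m * C / \<delta>"
      using \<open>0 \<le> m\<close> \<open>0 \<le> C\<close> \<open>0 < \<delta>\<close> by (simp add: B_def)
    then have "(\<delta> * B)\<^sup>2 = \<delta> * (2 * m * C)"
      using \<open>0 < \<delta>\<close> unfolding power_mult_distrib by (simp add: power2_eq_square)
    also have "\<dots> \<le> \<delta> * (2 * m * C + 1)"
      using \<open>0 < \<delta>\<close> by (intro mult_left_mono) auto
    also have "\<dots> = (\<epsilon> / 2)\<^sup>2"
      using \<open>0 < 2 * m * C + 1\<close> by (simp add: \<delta>_def)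
    finally show "(\<delta> * B)\<^sup>2 \<le> (\<epsilon> / 2)\<^sup>2" .
  qed (use \<open>0 < \<epsilon>\<close> in simp)
  define K where "K = 2 * C * B\<^sup>2 / 2 + m * (2 * C * B)"
  have "(\<lambda>l. fejer_defect TYPE('d) (2 * fc) l * K) \<longlonglongrightarrow> 0 * K"
    by (intro tendsto_intros tendsto_fejer_defect)
  then have "\<forall>\<^sub>F l in sequentially. fejer_defect TYPE('d) (2 * fc) l * K < \<epsilon> / 2"
    using \<open>0 < \<epsilon>\<close> by (intro order_tendstoD) auto
  then show ?thesis
    using eventually_ge_at_top[of "2 * fc"]
  proof (eventually_elim, intro allI impI)
    fix l R w \<tau>
    assume small: "fejer_defect TYPE('d) (2 * fc) l * K < \<epsilon> / 2" and l: "2 * fc \<le> l"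
      and feas: "relaxed_feasible fc z l R w \<tau>" and C: "(Re (R 0 0) + \<tau>) / 2 \<le> C"
    let ?r = "Re (R 0 0)" and ?\<kappa> = "fejer_defect TYPE('d) (2 * fc) l"
    have "0 \<le> ?\<kappa>"
      by (rule fejer_defect_nonneg)
    have psd: "psd_on (freqs l) R" "psd_on (insert None (Some ` freqs l)) (bordered R w \<tau>)"
      using feas by (auto simp: relaxed_feasible_def)
    have "0 \<le> ?r"
      using psd_on_diag_nonneg(1)[OF _ psd(1), of 0] by simp
    moreover have "0 \<le> \<tau>"
      using psd_on_diag_nonneg(1)[OF _ psd(2), of None] by simp
    ultimately have "?r \<le> 2 * C" "\<tau> \<le> 2 * C"
      using C by auto
    obtain S where "0 \<le> S" and S: "\<delta> * S\<^sup>2 \<le> m * \<tau>"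
      and Q: "Q0_value fc z \<le> ereal ((?r + \<tau>) / 2 + (?\<kappa> * ?r * S\<^sup>2 / 2 + \<delta> * S + m * (?\<kappa> * ?r * S)))"
      using Q0_value_le_relaxed[OF feas l \<open>0 < \<delta>\<close>] unfolding m_def by metis
    have "S \<le> B"
    proof -
      have "\<delta> * S\<^sup>2 \<le> m * (2 * C)"
        using S mult_left_mono[OF \<open>\<tau> \<le> 2 * C\<close> \<open>0 \<le> m\<close>] by simp
      then have "S\<^sup>2 \<le> 2 * m * C / \<delta>"
        using \<open>0 < \<delta>\<close> by (simp add: pos_le_divide_eq mult_ac)
      then show ?thesis
        unfolding B_def by (rule real_le_rsqrt)
    qed
    have "?r * S\<^sup>2 \<le> 2 * C * B\<^sup>2"
      using \<open>0 \<le> S\<close> \<open>S \<le> B\<close> \<open>?r \<le> 2 * C\<close> \<open>0 \<le> C\<close> by (intro mult_mono power_mono) auto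
    moreover have "m * (?r * S) \<le> m * (2 * C * B)"
      using \<open>0 \<le> S\<close> \<open>S \<le> B\<close> \<open>?r \<le> 2 * C\<close> \<open>0 \<le> C\<close> \<open>0 \<le> m\<close> by (intro mult_left_mono mult_mono) auto
    ultimately have "?r * S\<^sup>2 / 2 + m * (?r * S) \<le> K"
      by (simp add: K_def)
    then have "?\<kappa> * (?r * S\<^sup>2 / 2 + m * (?r * S)) \<le> ?\<kappa> * K"
      using \<open>0 \<le> ?\<kappa>\<close> by (rule mult_left_mono)
    moreover have "\<delta> * S \<le> \<epsilon> / 2"
      using \<open>0 < \<delta>\<close> by (intro order_trans[OF mult_left_mono[OF \<open>S \<le> B\<close>] \<delta>B]) simp
    ultimately have "?\<kappa> * ?r * S\<^sup>2 / 2 + \<delta> * S + m * (?\<kappa> * ?r * S) \<le> \<epsilon>"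
      using small by (simp add: algebra_simps)
    then have "ereal ((?r + \<tau>) / 2 + (?\<kappa> * ?r * S\<^sup>2 / 2 + \<delta> * S + m * (?\<kappa> * ?r * S))) \<le> ereal ((?r + \<tau>) / 2 + \<epsilon>)"
      by simp
    with Q show "Q0_value fc z \<le> ereal ((?r + \<tau>) / 2 + \<epsilon>)"
      by (rule order_trans)
  qed
qed

text \<open>Pick reals \<open>b < b'\<close> between \<open>a\<close> and the limit value. A feasible point of value below \<open>b\<close> at a high level
  would bound the limit value by \<open>b'\<close>.\<close>

lemma eventually_less_Q0_relaxed_value:
  fixes z :: "int ^ 'd::finite \<Rightarrow> complex"
  assumes "a < Q0_value fc z"
  shows "\<forall>\<^sub>F l in sequentially. a < Q0_relaxed_value fc z l"
proof -
  obtain b where b: "a < ereal b" "ereal b < Q0_value fc z"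
    using ereal_dense2[OF assms] by blast
  obtain b' where b': "ereal b < ereal b'" "ereal b' < Q0_value fc z"
    using ereal_dense2[OF b(2)] by blast
  have "\<forall>\<^sub>F l in sequentially. \<forall>R w \<tau>. relaxed_feasible fc z l R w \<tau> \<longrightarrow> (Re (R 0 0) + \<tau>) / 2 \<le> \<bar>b\<bar>
    \<longrightarrow> Q0_value fc z \<le> ereal ((Re (R 0 0) + \<tau>) / 2 + (b' - b))"
    using b'(1) by (intro eventually_Q0_value_le_relaxed) auto
  then show ?thesis
  proof eventually_elim
    case (elim l)
    have "ereal b \<le> Q0_relaxed_value fc z l"
      unfolding Q0_relaxed_value_eq
    proof (rule Inf_greatest, clarify)
      fix R w \<tau>
      assume feas: "relaxed_feasible fc z l R w \<tau>"
      show "ereal b \<le> ereal ((Re (R 0 0) + \<tau>) / 2)"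
      proof (rule ccontr)
        assume "\<not> ereal b \<le> ereal ((Re (R 0 0) + \<tau>) / 2)"
        then have less: "(Re (R 0 0) + \<tau>) / 2 < b" by simp
        then have "Q0_value fc z \<le> ereal ((Re (R 0 0) + \<tau>) / 2 + (b' - b))"
          using elim feas by simp
        also have "\<dots> \<le> ereal b'"
          using less by simp
        finally show False
          using b'(2) by simp
      qed
    qed
    with b(1) show ?case by (rule less_le_trans)
  qed
qed

theorem proposition2:
  fixes fc :: nat and z :: "int ^ 'd::finite \<Rightarrow> complex"
  assumes "fc \<ge> 1"
  shows "(\<forall>l\<ge>fc. Q0_relaxed_value fc z l \<le> Q0_relaxed_value fc z (l + 1) \<and>
                  Q0_relaxed_value fc z (l + 1) \<le> Q0_value fc z) \<and>
         (\<lambda>l. Q0_relaxed_value fc z l) \<longlonglongrightarrow> Q0_value fc z"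
proof (intro conjI allI impI)
  show "Q0_relaxed_value fc z l \<le> Q0_relaxed_value fc z (l + 1)" for l
    by (rule Q0_relaxed_value_mono) simp
  show "Q0_relaxed_value fc z (l + 1) \<le> Q0_value fc z" for l
    by (rule Q0_relaxed_value_le_Q0_value)
  show "(\<lambda>l. Q0_relaxed_value fc z l) \<longlonglongrightarrow> Q0_value fc z"
  proof (rule order_tendstoI)
    show "\<forall>\<^sub>F l in sequentially. a < Q0_relaxed_value fc z l" if "a < Q0_value fc z" for a
      using that by (rule eventually_less_Q0_relaxed_value)
    show "\<forall>\<^sub>F l in sequentially. Q0_relaxed_value fc z l < a" if "Q0_value fc z < a" for a
      using le_less_trans[OF Q0_relaxed_value_le_Q0_value that] by simp
  qed
qed

end
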